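(* Let $p_1\leqslant p_2$ and $\tilde p_1<\tilde p_2$ be finite real numbers such that $[p_1,p_2]\subset(\tilde p_1,\tilde p_2)$. Suppose that $\psi\in\mathcal C^3(\mathbb R,\mathbb R)$ is strictly concave with $\psi''<0$ and has a unique stationary point at $p_0\in(\tilde p_1,\tilde p_2)$. Assume that $U\in\mathcal C^1(\mathbb R,\mathbb C)$ satisfies $\mathrm{supp}\,U\subseteq[p_1,p_2]$. Then for every $\delta\in\big(\frac12,\frac34\big)$ and all $\omega>0$, $$\left|\int_{\mathbb R}U(p)\,e^{i\omega\psi(p)}\,dp-\sqrt{2\pi}\,e^{-i\frac\pi4}\,e^{i\omega\psi(p_0)}\,\frac{U(p_0)}{\sqrt{-\psi''(p_0)}}\,\omega^{-\frac12}\right|$$ $$\leqslant\Big(C_1(\psi,\delta,\tilde p_1,\tilde p_2)\,\|U'\|_{L^2(\mathbb R)}+C_2(\psi,\delta,\tilde p_1,\tilde p_2)\,\|U\|_{L^\infty(\mathbb R)}\Big)\,\omega^{-\delta},$$ where, writing $\|\cdot\|_\infty$ for the norm of $L^\infty(\tilde p_1,\tilde p_2)$ and $m=\min_{[\tilde p_1,\tilde p_2]}\{-\psi''\}$, $$C_1(\psi,\delta,\tilde p_1,\tilde p_2)=\frac{2^{\delta+1}L(\delta)}{\sqrt{3-4\delta}}(\tilde p_2-\tilde p_1)^{\frac{3-4\delta}2}\,\|\psi''\|_\infty^{\frac32-\delta}\,m^{-\frac32},$$ $$C_2(\psi,\delta,\tilde p_1,\tilde p_2)=\frac{2^{\delta-1}L(\delta)}{1-\delta}(\tilde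 p_2-\tilde p_1)^{2-2\delta}\Big(\|\psi''\|_\infty^{\frac52-\delta}\|\psi^{(3)}\|_\infty\,m^{-\frac72}+\tfrac13\|\psi''\|_\infty^{\frac72-\delta}\|\psi^{(3)}\|_\infty\,m^{-\frac92}\Big),$$ $$L(\delta)=\frac{\sqrt\pi}2\left(\frac1{2\sqrt\pi}+\sqrt{\frac1{4\pi}+\frac12}\right)^{2\delta-1}.$$
   Context: A stationary point of $\psi$ is a zero of $\psi'$. *)

theory Defs
  imports "HOL-Analysis.Analysis" "HOL-Probability.Essential_Supremum"
begin

definition C_k_real :: "nat \<Rightarrow> (real \<Rightarrow> real) \<Rightarrow> bool" where
  "C_k_real k f \<longleftrightarrow>
     (\<forall>j<k. \<forall>x. ((deriv ^^ j) f) differentiable (at x)) \<and> continuous_on UNIV ((deriv ^^ k) f)"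

definition strictly_concave_on :: "'a::real_vector set \<Rightarrow> ('a \<Rightarrow> real) \<Rightarrow> bool" where
  "strictly_concave_on S f \<longleftrightarrow> convex S \<and>
     (\<forall>x\<in>S. \<forall>y\<in>S. \<forall>t::real. x \<noteq> y \<longrightarrow> 0 < t \<longrightarrow> t < 1 \<longrightarrow>
        (1 - t) * f x + t * f y < f ((1 - t) *\<^sub>R x + t *\<^sub>R y))"

definition stationary_point :: "(real \<Rightarrow> real) \<Rightarrow> real \<Rightarrow> bool" where
  "stationary_point f p \<longleftrightarrow> deriv f p = 0"

(* The two norms are meaningful only for members of the respective space: the Bochner integral
   and real_of_ereal both return 0 in the case of an infinite norm. *)

definition norm_L2 :: "'a measure \<Rightarrow> ('a \<Rightarrow> 'b::real_normed_vector) \<Rightarrow> real" where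
  "norm_L2 M f = sqrt (LINT x|M. (norm (f x))\<^sup>2)"

definition norm_Linf :: "'a measure \<Rightarrow> ('a \<Rightarrow> 'b::real_normed_vector) \<Rightarrow> real" where
  "norm_Linf M f = real_of_ereal (esssup M (\<lambda>x. ereal (norm (f x))))"

abbreviation norm_Linf_ivl :: "real \<Rightarrow> real \<Rightarrow> (real \<Rightarrow> real) \<Rightarrow> real" where
  "norm_Linf_ivl a b f \<equiv> norm_Linf (restrict_space lborel {a<..<b}) f"

(* Min is restricted to finite sets, so the minimum over an interval is the least element of the
   image; it exists when the second derivative is continuous. *)
definition min_neg_deriv2 :: "(real \<Rightarrow> real) \<Rightarrow> real \<Rightarrow> real \<Rightarrow> real" where
  "min_neg_deriv2 \<psi> a b = (LEAST y. y \<in> (\<lambda>p. - (deriv ^^ 2) \<psi> p) ` {a..b})"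

definition L_const :: "real \<Rightarrow> real" where
  "L_const \<delta> = sqrt pi / 2 *
     (1 / (2 * sqrt pi) + sqrt (1 / (4 * pi) + 1 / 2)) powr (2 * \<delta> - 1)"

definition C1_const :: "(real \<Rightarrow> real) \<Rightarrow> real \<Rightarrow> real \<Rightarrow> real \<Rightarrow> real" where
  "C1_const \<psi> \<delta> a b =
     2 powr (\<delta> + 1) * L_const \<delta> / sqrt (3 - 4 * \<delta>) * (b - a) powr ((3 - 4 * \<delta>) / 2) *
     norm_Linf_ivl a b ((deriv ^^ 2) \<psi>) powr (3/2 - \<delta>) * min_neg_deriv2 \<psi> a b powr (-3/2)"

definition C2_const :: "(real \<Rightarrow> real) \<Rightarrow> real \<Rightarrow> real \<Rightarrow> real \<Rightarrow> real" where
  "C2_const \<psi> \<delta> a b =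
     2 powr (\<delta> - 1) * L_const \<delta> / (1 - \<delta>) * (b - a) powr (2 - 2 * \<delta>) *
     (norm_Linf_ivl a b ((deriv ^^ 2) \<psi>) powr (5/2 - \<delta>) * norm_Linf_ivl a b ((deriv ^^ 3) \<psi>) *
        min_neg_deriv2 \<psi> a b powr (-7/2)
      + 1/3 * norm_Linf_ivl a b ((deriv ^^ 2) \<psi>) powr (7/2 - \<delta>) *
        norm_Linf_ivl a b ((deriv ^^ 3) \<psi>) * min_neg_deriv2 \<psi> a b powr (-9/2))"

end

theory Submission
  imports Defs "HOL-Probability.Distributions" "HOL-Real_Asymp.Real_Asymp"
begin

text \<open>
  On either side of the stationary point the substitution \<open>s = sqrt (\<psi> p0 - \<psi> p)\<close> makes the phase
  exactly quadratic, so that the integrand becomes a multiple of \<open>exp (- \<i> * \<omega> * s\<^sup>2)\<close>. The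
  primitive of that function which vanishes at infinity is a rescaled Fresnel integral. Integrating by parts
  against it produces a boundary term at \<open>p0\<close>, which is half of the leading term, and a remainder
  containing the derivative of amplitude times Jacobian.

  Three facts bound the remainder.

  \<^item> The Fresnel primitive is \<open>O(1)\<close> near the origin and \<open>O(1/s)\<close> at infinity, as one sees by
    rotating the contour. Interpolation gives the bound \<open>L_const \<delta> * s powr (1 - 2 * \<delta>)\<close>
    (lemma \<open>norm_fresnel_primitive_le_L\<close>), and rescaling by \<open>\<omega>\<close> adds the
    factor \<open>\<omega> powr (- \<delta>)\<close>.

  \<^item> The Jacobian is bounded in terms of the minimum and the maximum of the negated second
    derivative of \<open>\<psi>\<close>. Its own derivative is a quotient of two quantities of third order at
    \<open>p0\<close> and therefore bounded once the third derivative of \<open>\<psi>\<close> is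
    (lemma \<open>jacobian'_bound\<close>).

  \<^item> The singular factor \<open>s powr (1 - 2 * \<delta>)\<close> is comparable to \<open>\<bar>p - p0\<bar> powr (1 - 2 * \<delta>)\<close>, which
    is square-integrable because \<open>\<delta> < 3/4\<close>. So the part of the remainder with \<open>U'\<close> is controlled
    by its norm in \<open>L\<^sup>2\<close>, the part with \<open>U\<close> by its supremum (lemma \<open>half_line_estimate\<close>).

  The constants that come out are at most the claimed ones (lemma \<open>constants_comparison\<close>).
\<close>

section \<open>The Fresnel primitive\<close>

text \<open>
  The primitive of \<open>exp (- \<i> * t\<^sup>2)\<close> that vanishes at infinity: the constant subtracted is the
  value of the Fresnel integral over the half-line. With this normalisation it equals minus the tail
  of the Fresnel integral, hence decays, and its value at the origin carries the leading
  coefficient of the asymptotic expansion.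
\<close>

definition fresnel_primitive :: "real \<Rightarrow> complex" where
  "fresnel_primitive s =
     integral {0..s} (\<lambda>t. exp (- \<i> * of_real (t\<^sup>2))) - exp (- (\<i> * of_real (pi / 4))) * of_real (sqrt pi / 2)"

text \<open>
  Rotating the tail \<open>{s..}\<close> of the contour by the angle \<open>-\<pi>/4\<close> about \<open>s\<close>, that is, putting
  \<open>t = s + r / eighth_root\<close>, turns \<open>exp (- \<i> * t\<^sup>2)\<close> into
  \<open>exp (- \<i> * s\<^sup>2)\<close> times a kernel with Gaussian decay in \<open>r\<close>.
\<close>

definition eighth_root :: complex where
  "eighth_root = cis (pi / 4)"

lemma eighth_root_square: "eighth_root * eighth_root = \<i>"
  by (simp add: eighth_root_def cis_mult cis_pi_half)

lemma Re_eighth_root: "Re eighth_root = sqrt 2 / 2"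
  by (simp add: eighth_root_def cos_45)

lemma norm_eighth_root: "cmod eighth_root = 1"
  by (simp add: eighth_root_def)

lemma eighth_root_nz: "eighth_root \<noteq> 0"
  using norm_eighth_root by auto

definition gauss_kernel :: "real \<Rightarrow> real \<Rightarrow> complex" where
  "gauss_kernel s r = exp (- of_real (r\<^sup>2) - 2 * eighth_root * of_real s * of_real r)"

text \<open>
  Minus the integral along the rotated ray, cut off at the parameter \<open>N\<close>. The cut-off keeps the
  domain of integration compact, so that differentiation under the integral sign is elementary and
  Cauchy's theorem is not called for.
\<close>

definition truncated_tail :: "real \<Rightarrow> real \<Rightarrow> complex" where
  "truncated_tail N s = - exp (- \<i> * of_real (s\<^sup>2)) / eighth_root * integral {0..N} (gauss_kernel s)"

lemma continuous_gauss_kernel: "continuous_on S (gauss_kernel s)"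
  unfolding gauss_kernel_def by (intro continuous_intros)

text \<open>
  Because \<open>eighth_root\<close> has positive real part, the linear term in the exponent also contributes
  decay for \<open>s > 0\<close>. This is the source of the bound by \<open>1 / s\<close> below.
\<close>

lemma norm_gauss_kernel: "cmod (gauss_kernel s r) = exp (- r\<^sup>2 - sqrt 2 * s * r)"
  by (simp add: gauss_kernel_def Re_eighth_root)

lemma gauss_kernel_deriv_r:
  "(gauss_kernel s has_vector_derivative (- 2 * of_real r - 2 * eighth_root * of_real s) * gauss_kernel s r) (at r within S)"
proof -
  have "((\<lambda>z. exp (- z\<^sup>2 - 2 * eighth_root * of_real s * z)) has_field_derivative
     (- 2 * of_real r - 2 * eighth_root * of_real s) * gauss_kernel s r) (at (of_real r))"
    unfolding gauss_kernel_def by (auto intro!: derivative_eq_intros)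
  then show ?thesis
    unfolding gauss_kernel_def[abs_def] of_real_power
    by (rule has_vector_derivative_real_field)
qed

lemma gauss_kernel_deriv_s:
  "((\<lambda>s. gauss_kernel s r) has_vector_derivative (- 2 * eighth_root * of_real r) * gauss_kernel s r) (at s within S)"
proof -
  have "((\<lambda>z. exp (- of_real (r\<^sup>2) - 2 * eighth_root * z * of_real r)) has_field_derivative
     (- 2 * eighth_root * of_real r) * gauss_kernel s r) (at (of_real s))"
    unfolding gauss_kernel_def by (auto intro!: derivative_eq_intros)
  then show ?thesis
    unfolding gauss_kernel_def
    by (rule has_vector_derivative_real_field)
qed

text \<open>
  The exponent \<open>- r\<^sup>2 - 2 \<alpha> s r\<close>, with \<open>\<alpha> = eighth_root\<close>, satisfies
  \<open>\<alpha> \<partial>\<^sub>r - \<partial>\<^sub>s = - 2 \<alpha>\<^sup>2 s = - 2 \<i> s\<close>, and the factor \<open>exp (- \<i> * s\<^sup>2)\<close> absorbs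
  the right-hand side. The \<open>s\<close>-derivative of the product is therefore an exact \<open>r\<close>-derivative under
  the integral, which leaves only the values of the kernel at the two ends of the ray.
\<close>

lemma truncated_tail_deriv:
  assumes "0 \<le> N"
  shows "(truncated_tail N has_vector_derivative
     exp (- \<i> * of_real (s\<^sup>2)) * (1 - gauss_kernel s N)) (at s within S)"
proof -
  let ?a = eighth_root
  define G where "G s = integral {0..N} (gauss_kernel s)" for s
  define K where "K = (\<lambda>s. integral {0..N} (\<lambda>r. (- 2 * ?a * of_real r) * gauss_kernel s r))"
  have cont: "continuous_on T (\<lambda>(x, r). (- 2 * ?a * of_real r) * gauss_kernel x r)" for T
    unfolding gauss_kernel_def split_beta by (intro continuous_intros)
  have "((\<lambda>x. integral (cbox 0 N) (gauss_kernel x)) has_vector_derivative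
      integral (cbox 0 N) (\<lambda>r. (- 2 * ?a * of_real r) * gauss_kernel s r)) (at s within UNIV)"
    by (rule leibniz_rule_vector_derivative[where fx="\<lambda>x r. (- 2 * ?a * of_real r) * gauss_kernel x r"])
      (use cont gauss_kernel_deriv_s[of _ _ UNIV] in
        \<open>auto intro!: integrable_continuous_real continuous_gauss_kernel\<close>)
  then have G': "(G has_vector_derivative K s) (at s within S)"
    unfolding G_def[abs_def] K_def by (simp add: has_vector_derivative_at_within)
  have "((\<lambda>r. (- 2 * of_real r - 2 * ?a * of_real s) * gauss_kernel s r) has_integral
      (gauss_kernel s N - gauss_kernel s 0)) {0..N}"
    by (rule fundamental_theorem_of_calculus[OF assms gauss_kernel_deriv_r])
  then have "((\<lambda>r. ?a * ((- 2 * of_real r - 2 * ?a * of_real s) * gauss_kernel s r)) has_integral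
      ?a * (gauss_kernel s N - gauss_kernel s 0)) {0..N}"
    by (rule has_integral_mult_right)
  moreover have "(\<lambda>r. ?a * ((- 2 * of_real r - 2 * ?a * of_real s) * gauss_kernel s r)) =
     (\<lambda>r. (- 2 * ?a * of_real r) * gauss_kernel s r - (2 * \<i> * of_real s) * gauss_kernel s r)"
    by (auto simp: fun_eq_iff algebra_simps eighth_root_square[symmetric])
  ultimately have I1: "((\<lambda>r. (- 2 * ?a * of_real r) * gauss_kernel s r - (2 * \<i> * of_real s) * gauss_kernel s r) has_integral
      ?a * (gauss_kernel s N - 1)) {0..N}"
    by (simp add: gauss_kernel_def)
  have I2: "((\<lambda>r. (- 2 * ?a * of_real r) * gauss_kernel s r - (2 * \<i> * of_real s) * gauss_kernel s r) has_integral
      (K s - (2 * \<i> * of_real s) * G s)) {0..N}"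
    unfolding K_def G_def
    by (intro has_integral_diff has_integral_mult_right integrable_integral
        integrable_continuous_real continuous_intros continuous_gauss_kernel)
  have KG: "K s - (2 * \<i> * of_real s) * G s = ?a * (gauss_kernel s N - 1)"
    by (rule has_integral_unique[OF I2 I1])
  have "(truncated_tail N has_vector_derivative
      - exp (- \<i> * of_real (s\<^sup>2)) / ?a * K s + (2 * \<i> * of_real s * exp (- \<i> * of_real (s\<^sup>2)) / ?a) * G s) (at s within S)"
    unfolding truncated_tail_def G_def[symmetric]
  proof (rule has_vector_derivative_mult[OF _ G'])
    have "((\<lambda>z. - exp (- \<i> * z\<^sup>2) / ?a) has_field_derivative
       2 * \<i> * of_real s * exp (- \<i> * of_real (s\<^sup>2)) / ?a) (at (of_real s))"
      using eighth_root_nz by (auto intro!: derivative_eq_intros)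
    then show "((\<lambda>s. - exp (- \<i> * of_real (s\<^sup>2)) / ?a) has_vector_derivative
       2 * \<i> * of_real s * exp (- \<i> * of_real (s\<^sup>2)) / ?a) (at s within S)"
      unfolding of_real_power by (rule has_vector_derivative_real_field)
  qed
  also have "- exp (- \<i> * of_real (s\<^sup>2)) / ?a * K s + (2 * \<i> * of_real s * exp (- \<i> * of_real (s\<^sup>2)) / ?a) * G s
      = - exp (- \<i> * of_real (s\<^sup>2)) / ?a * (K s - (2 * \<i> * of_real s) * G s)"
    by (simp add: algebra_simps)
  also have "\<dots> = exp (- \<i> * of_real (s\<^sup>2)) * (1 - gauss_kernel s N)"
    unfolding KG using eighth_root_nz by (simp add: divide_simps) (simp add: algebra_simps)
  finally show ?thesis .
qed

lemma gauss_half_line: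
  shows "integral {0..N} (\<lambda>r. exp (- r\<^sup>2)) \<le> sqrt pi / 2" (is ?le)
    and "(\<lambda>n::nat. integral {0..real n} (\<lambda>r. exp (- r\<^sup>2))) \<longlonglongrightarrow> sqrt pi / 2" (is ?lim)
proof -
  have hb: "has_bochner_integral lborel (\<lambda>x. indicator {0..} x *\<^sub>R exp (- x\<^sup>2)) (sqrt pi / 2)"
    by (rule gaussian_moment_0)
  have si: "set_integrable lborel {0..} (\<lambda>x::real. exp (- x\<^sup>2))"
    using hb unfolding set_integrable_def by (simp add: has_bochner_integral_iff)
  have abs: "(\<lambda>x::real. exp (- x\<^sup>2)) integrable_on {0..}" "integral {0..} (\<lambda>x::real. exp (- x\<^sup>2)) = sqrt pi / 2"
    using set_borel_integral_eq_integral[OF si] hb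
    unfolding set_lebesgue_integral_def by (simp_all add: has_bochner_integral_iff)
  have int: "(\<lambda>x::real. exp (- x\<^sup>2)) integrable_on {0..N}" for N
    by (intro integrable_continuous_real continuous_intros)
  show ?le
    unfolding abs(2)[symmetric] by (intro integral_subset_le int abs) auto
  have "((\<lambda>y. LINT x::real:{0..y}|lborel. exp (- x\<^sup>2)) \<longlongrightarrow> (LINT x::real:{0..}|lborel. exp (- x\<^sup>2))) at_top"
    by (rule tendsto_set_lebesgue_integral_at_top[OF _ si]) auto
  moreover have "(LINT x::real:{0..y}|lborel. exp (- x\<^sup>2)) = integral {0..y} (\<lambda>r::real. exp (- r\<^sup>2))" for y
    by (intro set_borel_integral_eq_integral borel_integrable_atLeastAtMost' continuous_intros)
  moreover have "(LINT x::real:{0..}|lborel. exp (- x\<^sup>2)) = sqrt pi / 2"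
    using hb unfolding set_lebesgue_integral_def by (simp add: has_bochner_integral_iff)
  ultimately have "((\<lambda>y. integral {0..y} (\<lambda>r::real. exp (- r\<^sup>2))) \<longlongrightarrow> sqrt pi / 2) at_top"
    by simp
  then show ?lim
    by (rule filterlim_compose) (rule filterlim_real_sequentially)
qed

text \<open>
  Drop either the linear or the quadratic part of the exponent of the kernel.
\<close>

lemma norm_truncated_tail:
  assumes "0 \<le> N" "0 \<le> s"
  shows "cmod (truncated_tail N s) \<le> sqrt pi / 2" "0 < s \<Longrightarrow> cmod (truncated_tail N s) \<le> 1 / (sqrt 2 * s)"
proof -
  have eq: "cmod (truncated_tail N s) = cmod (integral {0..N} (gauss_kernel s))"
    by (simp add: truncated_tail_def norm_mult norm_divide norm_eighth_root)
  have "cmod (integral {0..N} (gauss_kernel s)) \<le> integral {0..N} (\<lambda>r. exp (- r\<^sup>2))"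
    using assms
    by (intro integral_norm_bound_integral integrable_continuous_real continuous_intros continuous_gauss_kernel)
      (auto simp: norm_gauss_kernel)
  also have "\<dots> \<le> sqrt pi / 2" by (rule gauss_half_line)
  finally show "cmod (truncated_tail N s) \<le> sqrt pi / 2" using eq by simp
  assume s: "0 < s"
  define c where "c = sqrt 2 * s"
  have c: "c > 0" using s by (simp add: c_def)
  have "cmod (integral {0..N} (gauss_kernel s)) \<le> integral {0..N} (\<lambda>r. exp (- (c * r)))"
    by (intro integral_norm_bound_integral integrable_continuous_real continuous_intros continuous_gauss_kernel)
      (auto simp: norm_gauss_kernel c_def)
  also have "integral {0..N} (\<lambda>r. exp (- (c * r))) = - exp (- (c * N)) / c - (- exp (- (c * 0)) / c)"
  proof (intro integral_unique fundamental_theorem_of_calculus assms)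
    show "((\<lambda>r. - exp (- (c * r)) / c) has_vector_derivative exp (- (c * r))) (at r within {0..N})" for r
      using c unfolding has_real_derivative_iff_has_vector_derivative[symmetric]
      by (auto intro!: derivative_eq_intros)
  qed
  also have "\<dots> \<le> 1 / c" using c by (simp add: diff_divide_distrib[symmetric] divide_right_mono)
  finally show "cmod (truncated_tail N s) \<le> 1 / (sqrt 2 * s)"
    unfolding eq c_def .
qed

text \<open>
  At \<open>s = 0\<close> the truncated tail is a Gaussian integral, and up to an error of size
  \<open>exp (- N\<^sup>2)\<close> its derivative is that of the Fresnel primitive. All bounds that are
  uniform in \<open>N\<close> are inherited by the limit.
\<close>

lemma truncated_tail_tendsto:
  assumes "0 \<le> s"
  shows "(\<lambda>n. truncated_tail (real n) s) \<longlonglongrightarrow> fresnel_primitive s"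
proof -
  have inv: "1 / eighth_root = exp (- (\<i> * of_real (pi / 4)))"
    unfolding eighth_root_def cis_conv_exp exp_minus inverse_eq_divide ..
  have at0: "truncated_tail N 0 = - (1 / eighth_root) * of_real (integral {0..N} (\<lambda>r. exp (- r\<^sup>2)))" for N
  proof -
    have "gauss_kernel 0 = (\<lambda>r. of_real (exp (- r\<^sup>2)))"
      by (simp add: gauss_kernel_def fun_eq_iff flip: exp_of_real)
    moreover have "((\<lambda>r. of_real (exp (- r\<^sup>2)) :: complex) has_integral of_real (integral {0..N} (\<lambda>r. exp (- r\<^sup>2)))) {0..N}"
      by (intro has_integral_of_real integrable_integral integrable_continuous_real continuous_intros)
    ultimately show ?thesis by (simp add: truncated_tail_def integral_unique)
  qed
  have lim0: "(\<lambda>n. truncated_tail (real n) 0) \<longlonglongrightarrow> - (1 / eighth_root) * of_real (sqrt pi / 2)"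
    unfolding at0 by (intro tendsto_intros gauss_half_line)
  have diff: "((\<lambda>t. exp (- \<i> * of_real (t\<^sup>2)) * (1 - gauss_kernel t N)) has_integral
      (truncated_tail N s - truncated_tail N 0)) {0..s}" if "0 \<le> N" for N
    by (rule fundamental_theorem_of_calculus[OF assms truncated_tail_deriv[OF that]])
  have I0: "((\<lambda>t. exp (- \<i> * of_real (t\<^sup>2))) has_integral integral {0..s} (\<lambda>t. exp (- \<i> * of_real (t\<^sup>2)))) {0..s}"
    by (intro integrable_integral integrable_continuous_real continuous_intros)
  have bound: "cmod (truncated_tail (real n) s - truncated_tail (real n) 0 - integral {0..s} (\<lambda>t. exp (- \<i> * of_real (t\<^sup>2))))
      \<le> exp (- (real n)\<^sup>2) * s" for n
  proof -
    have I: "((\<lambda>t. exp (- \<i> * of_real (t\<^sup>2)) * (1 - gauss_kernel t n) - exp (- \<i> * of_real (t\<^sup>2))) has_integral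
      (truncated_tail n s - truncated_tail n 0 - integral {0..s} (\<lambda>t. exp (- \<i> * of_real (t\<^sup>2))))) (cbox 0 s)"
      using has_integral_diff[OF diff[of n] I0] by simp
    have "cmod (truncated_tail n s - truncated_tail n 0 - integral {0..s} (\<lambda>t. exp (- \<i> * of_real (t\<^sup>2))))
       \<le> exp (- (real n)\<^sup>2) * measure lborel (cbox 0 s)"
    proof (rule has_integral_bound[OF _ I])
      show "cmod (exp (- \<i> * of_real (t\<^sup>2)) * (1 - gauss_kernel t n) - exp (- \<i> * of_real (t\<^sup>2)))
          \<le> exp (- (real n)\<^sup>2)" if "t \<in> cbox 0 s" for t
        using that by (simp add: right_diff_distrib norm_mult norm_gauss_kernel)
    qed simp
    then show ?thesis using assms by simp
  qed
  have "(\<lambda>n. truncated_tail (real n) s - truncated_tail (real n) 0 - integral {0..s} (\<lambda>t. exp (- \<i> * of_real (t\<^sup>2)))) \<longlonglongrightarrow> 0"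
  proof (rule Lim_null_comparison[OF always_eventually])
    show "\<forall>n. cmod (truncated_tail (real n) s - truncated_tail (real n) 0 - integral {0..s} (\<lambda>t. exp (- \<i> * of_real (t\<^sup>2))))
      \<le> exp (- (real n)\<^sup>2) * s" using bound by blast
    show "(\<lambda>n. exp (- (real n)\<^sup>2) * s) \<longlonglongrightarrow> 0" by real_asymp
  qed
  from tendsto_add[OF tendsto_add[OF this lim0] tendsto_const[of "integral {0..s} (\<lambda>t. exp (- \<i> * of_real (t\<^sup>2)))"]]
  show ?thesis by (simp add: fresnel_primitive_def inv)
qed

lemma norm_fresnel_primitive:
  assumes "0 \<le> s"
  shows "cmod (fresnel_primitive s) \<le> sqrt pi / 2"
    and "0 < s \<Longrightarrow> cmod (fresnel_primitive s) \<le> 1 / (sqrt 2 * s)"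
  using assms norm_truncated_tail
  by (blast intro: Lim_bounded[OF tendsto_norm[OF truncated_tail_tendsto[OF assms]], where M = 0] of_nat_0_le_iff)+

lemma L_const_pos: "0 < L_const \<delta>"
proof -
  have "0 < 1 / (2 * sqrt pi) + sqrt (1 / (4 * pi) + 1 / 2)"
    by (intro add_pos_pos real_sqrt_gt_zero divide_pos_pos) auto
  then show ?thesis by (simp add: L_const_def)
qed

text \<open>
  Geometric interpolation, with weight \<open>2\<delta> - 1\<close>, between the bounds \<open>\<surd>\<pi> / 2\<close> and
  \<open>\<surd>\<pi> / 2 * x / s\<close>, where \<open>x\<close> is the base of the power in \<open>L_const\<close>. The second bound follows
  from the sharper \<open>1 / (\<surd>2 * s)\<close> because \<open>x \<ge> 1\<close>.
\<close>

lemma norm_fresnel_primitive_le_L: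
  assumes s: "0 < s" and d: "1/2 < \<delta>" "\<delta> < 3/4"
  shows "cmod (fresnel_primitive s) \<le> L_const \<delta> * s powr (1 - 2 * \<delta>)"
proof -
  define \<theta> where "\<theta> = 2 * \<delta> - 1"
  have \<theta>: "0 < \<theta>" "\<theta> < 1" using d by (auto simp: \<theta>_def)
  define x where "x = 1 / (2 * sqrt pi) + sqrt (1 / (4 * pi) + 1 / 2)"
  let ?E = "cmod (fresnel_primitive s)"
  have pi_le: "sqrt pi \<le> 2" using pi_less_4 by (simp add: real_le_lsqrt)
  have "sqrt (9/16) \<le> sqrt (1 / (4 * pi) + 1 / 2)"
    using pi_less_4 by (intro real_sqrt_le_mono) (simp add: field_simps)
  moreover have "sqrt (9/16) = (3/4::real)" by (rule real_sqrt_unique) (auto simp: power2_eq_square)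
  moreover have "1/4 \<le> 1 / (2 * sqrt pi)" using pi_le by (simp add: field_simps)
  ultimately have x: "x \<ge> 1" unfolding x_def by linarith
  have "1 / (sqrt 2 * s) \<le> sqrt pi / 2 * (x / s)"
  proof -
    have "1 \<le> sqrt 2 * sqrt pi / 2"
    proof -
      have "4 \<le> 2 * pi" using pi_gt3 by simp
      then have "sqrt 4 \<le> sqrt (2 * pi)" by (rule real_sqrt_le_mono)
      then show ?thesis by (simp add: real_sqrt_mult)
    qed
    also have "\<dots> \<le> sqrt 2 * sqrt pi / 2 * x" using x by simp
    finally show ?thesis using s by (simp add: field_simps)
  qed
  with norm_fresnel_primitive[of s] s have E: "?E \<le> sqrt pi / 2" "?E \<le> sqrt pi / 2 * (x / s)" by auto
  have "?E \<le> sqrt pi / 2 * (x / s) powr \<theta>"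
  proof (cases "x / s \<ge> 1")
    case True
    then have "1 \<le> (x / s) powr \<theta>" using \<theta> by (simp add: ge_one_powr_ge_zero)
    then have "sqrt pi / 2 * 1 \<le> sqrt pi / 2 * (x / s) powr \<theta>" by (intro mult_left_mono) auto
    then show ?thesis using E(1) by linarith
  next
    case False
    have "(x / s) powr 1 \<le> (x / s) powr \<theta>"
      using False x s \<theta> by (intro powr_mono') auto
    then have "sqrt pi / 2 * (x / s) \<le> sqrt pi / 2 * (x / s) powr \<theta>"
      using x s by (intro mult_left_mono) auto
    then show ?thesis using E(2) by linarith
  qed
  also have "(x / s) powr \<theta> = x powr \<theta> * s powr (1 - 2 * \<delta>)"
    using x s by (simp add: powr_divide \<theta>_def powr_diff divide_simps flip: powr_add)
  finally show ?thesis
    unfolding L_const_def x_def[symmetric] \<theta>_def[symmetric] by (simp add: mult.assoc)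
qed

lemma fresnel_primitive_0: "fresnel_primitive 0 = - exp (- (\<i> * of_real (pi / 4))) * of_real (sqrt pi / 2)"
  by (simp add: fresnel_primitive_def)

lemma fresnel_primitive_deriv:
  assumes "0 < s"
  shows "(fresnel_primitive has_vector_derivative exp (- \<i> * of_real (s\<^sup>2))) (at s)"
proof -
  have "((\<lambda>u. integral {0..u} (\<lambda>t. exp (- \<i> * of_real (t\<^sup>2)))) has_vector_derivative exp (- \<i> * of_real (s\<^sup>2))) (at s within {0..s+1})"
    using assms by (intro integral_has_vector_derivative continuous_intros) auto
  then have "((\<lambda>u. integral {0..u} (\<lambda>t. exp (- \<i> * of_real (t\<^sup>2)))) has_vector_derivative exp (- \<i> * of_real (s\<^sup>2))) (at s)"
    using assms by (subst (asm) at_within_interior) auto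
  then show ?thesis
    using has_vector_derivative_diff[OF _ has_vector_derivative_const, of _ _ "at s" "exp (- (\<i> * of_real (pi / 4))) * of_real (sqrt pi / 2)"]
    unfolding fresnel_primitive_def by force
qed

lemma continuous_fresnel_primitive: "continuous_on {0..b} fresnel_primitive"
  unfolding fresnel_primitive_def
  by (intro continuous_intros indefinite_integral_continuous_1 integrable_continuous_real)

section \<open>One side of the stationary point\<close>

text \<open>
  A way to obtain the Cauchy--Schwarz inequality from Young's inequality with a free parameter
  \<open>t\<close>: the right-hand side is optimal at \<open>t = \<surd>(Q / P)\<close>, or in the limit \<open>t \<rightarrow> \<infinity>\<close> if
  \<open>P = 0\<close>. Only the squares of the factors need to be integrable then, not their product.
\<close>

lemma le_sqrt_mult_of_Young:
  fixes R P Q :: real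
  assumes le: "\<And>t. 0 < t \<Longrightarrow> R \<le> t / 2 * P + 1 / (2 * t) * Q" and P: "0 \<le> P" and Q: "0 < Q"
  shows "R \<le> sqrt P * sqrt Q"
proof (cases "P = 0")
  case False
  define p q where "p = sqrt P" and "q = sqrt Q"
  have pq: "0 < p" "0 < q" "P = p * p" "Q = q * q"
    using assms False by (auto simp: p_def q_def)
  have "R \<le> (q / p) / 2 * P + 1 / (2 * (q / p)) * Q"
    using pq by (intro le) auto
  also have "\<dots> = p * q" using pq by (simp add: field_simps)
  finally show ?thesis by (simp add: p_def q_def)
next
  case True
  have "R \<le> 0"
  proof (rule field_le_epsilon)
    fix e :: real assume e: "0 < e"
    show "R \<le> 0 + e" using le[of "Q / (2 * e)"] True e Q by simp
  qed
  with True show ?thesis by simp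
qed

text \<open>
  The situation on one side of the stationary point, moved to the origin and with the phase negated so
  that it has a minimum there. The large parameter is regarded as part of \<open>f\<close>: it multiplies
  \<open>m\<close>, \<open>M\<close> and \<open>T\<close> alike. The differentiability assumptions concern the whole line, so that the
  endpoints \<open>0\<close> and \<open>b\<close> need no one-sided derivatives.
\<close>

locale half_line_phase =
  fixes b m M T :: real and f f1 f2 f3 :: "real \<Rightarrow> real"
  assumes b: "0 < b" and m: "0 < m"
    and f: "\<And>x. (f has_real_derivative f1 x) (at x)"
    and f1: "\<And>x. (f1 has_real_derivative f2 x) (at x)"
    and f2: "\<And>x. (f2 has_real_derivative f3 x) (at x)"
    and f_0: "f 0 = 0" and f1_0: "f1 0 = 0"
    and f2_bounds: "\<And>x. x \<in> {0..b} \<Longrightarrow> m \<le> f2 x \<and> f2 x \<le> M"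
    and f3_bound: "\<And>x. x \<in> {0..b} \<Longrightarrow> \<bar>f3 x\<bar> \<le> T"
begin

lemma m_le_M: "m \<le> M"
  using f2_bounds[of 0] b by auto

lemma M_pos: "0 < M"
  using m_le_M m by simp

lemma T_nonneg: "0 \<le> T"
  using f3_bound[of 0] b by auto

lemma nonneg_of_deriv:
  fixes g g' :: "real \<Rightarrow> real"
  assumes "x \<in> {0..b}" "g 0 = 0" "\<And>y. (g has_real_derivative g' y) (at y)"
    "\<And>y. y \<in> {0..b} \<Longrightarrow> 0 \<le> g' y"
  shows "0 \<le> g x"
proof -
  have "g 0 \<le> g x"
  proof (rule DERIV_nonneg_imp_nondecreasing[of 0 x g])
    show "\<exists>y. (g has_real_derivative y) (at u) \<and> 0 \<le> y" if "0 \<le> u" "u \<le> x" for u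
      using that assms(1) assms(3)[of u] assms(4)[of u] by auto
  qed (use assms in auto)
  with assms show ?thesis by simp
qed

lemma f1_bounds:
  assumes "x \<in> {0..b}"
  shows "m * x \<le> f1 x" "f1 x \<le> M * x"
proof -
  show "m * x \<le> f1 x"
    using nonneg_of_deriv[OF assms, of "\<lambda>y. f1 y - m * y" "\<lambda>y. f2 y - m"] f2_bounds
    by (force simp: f1_0 intro!: derivative_eq_intros f1)
  show "f1 x \<le> M * x"
    using nonneg_of_deriv[OF assms, of "\<lambda>y. M * y - f1 y" "\<lambda>y. M - f2 y"] f2_bounds
    by (force simp: f1_0 intro!: derivative_eq_intros f1)
qed

lemma f_bounds:
  assumes "x \<in> {0..b}"
  shows "m / 2 * x\<^sup>2 \<le> f x" "f x \<le> M / 2 * x\<^sup>2"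
proof -
  show "m / 2 * x\<^sup>2 \<le> f x"
    using nonneg_of_deriv[OF assms, of "\<lambda>y. f y - m / 2 * y\<^sup>2" "\<lambda>y. f1 y - m * y"] f1_bounds
    by (force simp: f_0 intro!: derivative_eq_intros f)
  show "f x \<le> M / 2 * x\<^sup>2"
    using nonneg_of_deriv[OF assms, of "\<lambda>y. M / 2 * y\<^sup>2 - f y" "\<lambda>y. M * y - f1 y"] f1_bounds
    by (force simp: f_0 intro!: derivative_eq_intros f)
qed

lemma f_pos: "x \<in> {0<..b} \<Longrightarrow> 0 < f x"
  using f_bounds(1)[of x] m by (smt (verit) greaterThanAtMost_iff atLeastAtMost_iff mult_pos_pos half_gt_zero zero_less_power)

lemma f1_pos: "x \<in> {0<..b} \<Longrightarrow> 0 < f1 x"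
  using f1_bounds(1)[of x] m by (auto intro: less_le_trans[rotated])

lemma f_nonneg: "x \<in> {0..b} \<Longrightarrow> 0 \<le> f x"
  using f_bounds(1)[of x] m by (smt (verit) mult_nonneg_nonneg half_gt_zero zero_le_power2)

text \<open>
  The derivatives of \<open>f1\<^sup>2\<close> and of \<open>2 f f2\<close> cancel up to \<open>- 2 f f3\<close>, which is of second order at
  the origin. So the difference, which is the numerator of the derivative of the Jacobian below, is
  of third order, and this makes that derivative bounded.
\<close>

lemma defect_bound:
  assumes "x \<in> {0..b}"
  shows "\<bar>(f1 x)\<^sup>2 - 2 * f x * f2 x\<bar> \<le> T * M / 3 * x ^ 3"
proof -
  have D: "((\<lambda>y. (f1 y)\<^sup>2 - 2 * f y * f2 y) has_real_derivative - 2 * f y * f3 y) (at y)" for y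
    by (auto intro!: derivative_eq_intros f f1 f2)
  have bound: "\<bar>2 * f y * f3 y\<bar> \<le> T * M * y\<^sup>2" if "y \<in> {0..b}" for y
  proof -
    have "\<bar>2 * f y * f3 y\<bar> = 2 * f y * \<bar>f3 y\<bar>"
      using f_nonneg[OF that] by (simp add: abs_mult)
    also have "\<dots> \<le> (M * y\<^sup>2) * T"
    proof (rule mult_mono)
      show "2 * f y \<le> M * y\<^sup>2" using f_bounds(2)[OF that] by simp
    qed (use f3_bound[OF that] M_pos in auto)
    finally show ?thesis by (simp add: ac_simps)
  qed
  have cubic: "((\<lambda>y. T * M / 3 * y ^ 3) has_real_derivative T * M * y\<^sup>2) (at y)" for y
    by (rule DERIV_cong[OF DERIV_cmult[OF DERIV_pow]]) simp
  have "0 \<le> T * M / 3 * x ^ 3 - ((f1 x)\<^sup>2 - 2 * f x * f2 x)"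
  proof (rule nonneg_of_deriv[OF assms, of "\<lambda>y. T * M / 3 * y ^ 3 - ((f1 y)\<^sup>2 - 2 * f y * f2 y)"])
    show "0 \<le> T * M * y\<^sup>2 - (- 2 * f y * f3 y)" if "y \<in> {0..b}" for y
      using bound[OF that] by linarith
  qed (simp add: f_0 f1_0, rule DERIV_diff[OF cubic D])
  moreover have "0 \<le> T * M / 3 * x ^ 3 + ((f1 x)\<^sup>2 - 2 * f x * f2 x)"
  proof (rule nonneg_of_deriv[OF assms, of "\<lambda>y. T * M / 3 * y ^ 3 + ((f1 y)\<^sup>2 - 2 * f y * f2 y)"])
    show "0 \<le> T * M * y\<^sup>2 + (- 2 * f y * f3 y)" if "y \<in> {0..b}" for y
      using bound[OF that] by linarith
  qed (simp add: f_0 f1_0, rule DERIV_add[OF cubic D])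
  ultimately show ?thesis by linarith
qed

text \<open>
  The derivative of \<open>x\<close> with respect to the new variable \<open>s = sqrt (f x)\<close>, which makes the phase
  exactly quadratic. The quotient is \<open>0/0\<close> at the origin, where the limit is put in.
\<close>

definition jacobian :: "real \<Rightarrow> real" where
  "jacobian x = (if x = 0 then sqrt (2 / f2 0) else 2 * sqrt (f x) / f1 x)"

definition jacobian' :: "real \<Rightarrow> real" where
  "jacobian' x = ((f1 x)\<^sup>2 - 2 * f x * f2 x) / (sqrt (f x) * (f1 x)\<^sup>2)"

lemma jacobian_bounds:
  assumes "x \<in> {0<..b}"
  shows "0 < jacobian x" "jacobian x \<le> sqrt 2 * sqrt M / m"
proof -
  show "0 < jacobian x" using assms f_pos[OF assms] f1_pos[OF assms] by (simp add: jacobian_def)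
  have x: "0 < x" "x \<in> {0..b}" using assms by auto
  have "sqrt (f x) \<le> sqrt (M / 2 * x\<^sup>2)" using f_bounds(2)[OF x(2)] by simp
  also have "\<dots> = sqrt M / sqrt 2 * x" using x by (simp add: real_sqrt_mult real_sqrt_divide)
  finally have "2 * sqrt (f x) \<le> 2 * (sqrt M / sqrt 2 * x)" by simp
  then have "2 * sqrt (f x) / f1 x \<le> 2 * (sqrt M / sqrt 2 * x) / (m * x)"
    using f1_bounds(1)[OF x(2)] x m M_pos by (intro frac_le) auto
  also have "\<dots> = sqrt 2 * sqrt M / m" using x m by (simp add: field_simps)
  finally show "jacobian x \<le> sqrt 2 * sqrt M / m" using x by (simp add: jacobian_def)
qed

lemma jacobian_deriv:
  assumes "x \<in> {0<..b}"
  shows "(jacobian has_real_derivative jacobian' x) (at x)"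
proof -
  define s where "s = sqrt (f x)"
  have p: "0 < f x" "0 < f1 x" "0 < s" "f x = s * s"
    using f_pos[OF assms] f1_pos[OF assms] by (auto simp: s_def)
  have "((\<lambda>y. 2 * sqrt (f y) / f1 y) has_real_derivative jacobian' x) (at x)"
    unfolding jacobian'_def
  proof (rule DERIV_cong[OF DERIV_divide[OF DERIV_cmult[OF DERIV_chain2[OF DERIV_real_sqrt[OF p(1)] f]] f1]])
    show "(2 * (inverse (sqrt (f x)) / 2 * f1 x) * f1 x - 2 * sqrt (f x) * f2 x) / (f1 x * f1 x)
      = ((f1 x)\<^sup>2 - 2 * f x * f2 x) / (sqrt (f x) * (f1 x)\<^sup>2)"
      using p(2,3) unfolding s_def[symmetric] p(4) by (simp add: field_simps power2_eq_square)
  qed (use p in simp)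
  then show ?thesis
  proof (rule has_field_derivative_transform_within_open[of _ _ _ "{0<..}"])
    show "2 * sqrt (f y) / f1 y = jacobian y" if "y \<in> {0<..}" for y using that by (simp add: jacobian_def)
  qed (use assms in auto)
qed

text \<open>
  Numerator and denominator both vanish to third order at the origin. This is where the third
  derivative of the phase enters.
\<close>

lemma jacobian'_bound:
  assumes "x \<in> {0<..b}"
  shows "\<bar>jacobian' x\<bar> \<le> sqrt 2 / 3 * T * M / (sqrt m * m\<^sup>2)"
proof -
  have x: "0 < x" "x \<in> {0..b}" using assms by auto
  have "sqrt (m / 2 * x\<^sup>2) \<le> sqrt (f x)" by (intro real_sqrt_le_mono f_bounds(1) x)
  moreover have "sqrt (m / 2 * x\<^sup>2) = sqrt m / sqrt 2 * x" using x by (simp add: real_sqrt_mult real_sqrt_divide)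
  ultimately have s: "sqrt m / sqrt 2 * x \<le> sqrt (f x)" by metis
  have "\<bar>jacobian' x\<bar> = \<bar>(f1 x)\<^sup>2 - 2 * f x * f2 x\<bar> / (sqrt (f x) * (f1 x)\<^sup>2)"
    using f_nonneg[OF x(2)] by (simp add: jacobian'_def abs_mult)
  also have "\<dots> \<le> (T * M / 3 * x ^ 3) / (sqrt m / sqrt 2 * x * (m * x)\<^sup>2)"
    using defect_bound[OF x(2)] f_nonneg[OF x(2)] s f1_bounds(1)[OF x(2)] x m T_nonneg M_pos
    by (intro frac_le mult_mono power_mono) auto
  also have "\<dots> = sqrt 2 / 3 * T * M / (sqrt m * m\<^sup>2)"
    using x m by (simp add: field_simps power2_eq_square power3_eq_cube)
  finally show ?thesis .
qed

text \<open>
  By l'Hopital's rule for \<open>f / f1\<^sup>2\<close>, a quarter of the square of the Jacobian.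
\<close>

lemma jacobian_continuous_at_0: "(jacobian \<longlongrightarrow> jacobian 0) (at_right 0)"
proof -
  have f2_0: "0 < f2 0" using f2_bounds[of 0] b m by auto
  have cont: "isCont f 0" "isCont f1 0" "isCont f2 0"
    by (rule DERIV_isCont[OF f] DERIV_isCont[OF f1] DERIV_isCont[OF f2])+
  have lim: "(f \<longlongrightarrow> 0) (at_right 0)" "(f1 \<longlongrightarrow> 0) (at_right 0)" "(f2 \<longlongrightarrow> f2 0) (at_right 0)"
    using cont[unfolded isCont_def, THEN tendsto_within_subset[OF _ subset_UNIV]]
    by (simp_all only: f_0 f1_0)
  have ev: "eventually (\<lambda>x. x \<in> {0<..<b}) (at_right 0)"
    using b by (rule eventually_at_right_real)
  have "((\<lambda>x. f x / (f1 x)\<^sup>2) \<longlongrightarrow> 1 / (2 * f2 0)) (at_right 0)"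
  proof (rule lhopital_right_0[where f' = f1 and g' = "\<lambda>x. 2 * f1 x * f2 x"])
    show "(f \<longlongrightarrow> 0) (at_right 0)" by (rule lim)
    show "((\<lambda>x. (f1 x)\<^sup>2) \<longlongrightarrow> 0) (at_right 0)" using tendsto_power[OF lim(2), of 2] by simp
    have ev1: "eventually (\<lambda>x. 0 < f1 x \<and> 0 < f2 x) (at_right 0)"
      using ev
    proof eventually_elim
      case (elim x)
      then show ?case using f1_pos[of x] f2_bounds[of x] m by auto
    qed
    show "eventually (\<lambda>x. (f1 x)\<^sup>2 \<noteq> 0) (at_right 0)" "eventually (\<lambda>x. 2 * f1 x * f2 x \<noteq> 0) (at_right 0)"
      using ev1 by (auto elim!: eventually_mono)
    show "eventually (\<lambda>x. (f has_real_derivative f1 x) (at x)) (at_right 0)"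
      "eventually (\<lambda>x. ((\<lambda>x. (f1 x)\<^sup>2) has_real_derivative 2 * f1 x * f2 x) (at x)) (at_right 0)"
      by (auto intro!: always_eventually f derivative_eq_intros f1)
    have "((\<lambda>x. 1 / (2 * f2 x)) \<longlongrightarrow> 1 / (2 * f2 0)) (at_right 0)"
      using f2_0 by (intro tendsto_intros lim) auto
    moreover have "eventually (\<lambda>x. 1 / (2 * f2 x) = f1 x / (2 * f1 x * f2 x)) (at_right 0)"
      using ev1 by eventually_elim auto
    ultimately show "((\<lambda>x. f1 x / (2 * f1 x * f2 x)) \<longlongrightarrow> 1 / (2 * f2 0)) (at_right 0)"
      by (rule Lim_transform_eventually)
  qed
  then have lim_sqrt: "((\<lambda>x. sqrt (4 * (f x / (f1 x)\<^sup>2))) \<longlongrightarrow> sqrt (4 * (1 / (2 * f2 0)))) (at_right 0)"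
    by (rule tendsto_real_sqrt[OF tendsto_mult[OF tendsto_const]])
  have jacobian_0: "sqrt (4 * (1 / (2 * f2 0))) = jacobian 0" by (simp add: jacobian_def)
  have ev_eq: "eventually (\<lambda>x. sqrt (4 * (f x / (f1 x)\<^sup>2)) = jacobian x) (at_right 0)"
    using ev
  proof eventually_elim
    case (elim x)
    then show ?case using f1_pos[of x] by (simp add: jacobian_def real_sqrt_mult real_sqrt_divide)
  qed
  show ?thesis using Lim_transform_eventually[OF lim_sqrt ev_eq] unfolding jacobian_0 .
qed

lemma continuous_jacobian: "continuous_on {0..b} jacobian"
  unfolding continuous_on_def
proof
  fix x assume x: "x \<in> {0..b}"
  show "(jacobian \<longlongrightarrow> jacobian x) (at x within {0..b})"
  proof (cases "x = 0")
    case True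
    have "(jacobian \<longlongrightarrow> jacobian 0) (at 0 within {0..})"
      using jacobian_continuous_at_0 by (simp add: at_within_Ici_at_right)
    then show ?thesis unfolding True by (rule tendsto_within_subset) auto
  next
    case False
    then have "isCont jacobian x" using jacobian_deriv[of x] x by (auto intro: DERIV_isCont)
    then show ?thesis unfolding isCont_def by (rule tendsto_within_subset) simp
  qed
qed

text \<open>
  Up to the amplitude \<open>V * jacobian\<close>, the integrand \<open>V * exp (- \<i> * f)\<close> is the derivative of
  \<open>fresnel_primitive (sqrt f)\<close>. Integration by parts leaves the boundary term at the origin, which
  is the leading term of the expansion, and the integral of
  \<open>(V * jacobian)' * fresnel_primitive (sqrt f)\<close>. There the Fresnel primitive is bounded by a multiple of
  \<open>x powr (1 - 2 * \<delta>)\<close>. The square of this power is integrable since \<open>\<delta> < 3/4\<close>, so the part with \<open>V'\<close>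
  admits the Cauchy--Schwarz inequality; the part with \<open>V\<close> only needs the power itself.
\<close>

lemma half_line_estimate:
  fixes V V' :: "real \<Rightarrow> complex"
  assumes V: "\<And>x. (V has_vector_derivative V' x) (at x)" and V': "continuous_on {0..b} V'"
    and Vb: "V b = 0" and K: "\<And>x. x \<in> {0..b} \<Longrightarrow> cmod (V x) \<le> K"
    and \<delta>: "1/2 < \<delta>" "\<delta> < 3/4"
  shows "cmod (integral {0..b} (\<lambda>x. V x * exp (- \<i> * of_real (f x)))
      - of_real (sqrt (2 * pi) / 2) * exp (- (\<i> * of_real (pi / 4))) * (V 0 / of_real (sqrt (f2 0))))
    \<le> L_const \<delta> * (m / 2) powr (1/2 - \<delta>) *
      (sqrt 2 * sqrt M / m * (sqrt (integral {0..b} (\<lambda>x. (cmod (V' x))\<^sup>2)) * sqrt (b powr (3 - 4 * \<delta>) / (3 - 4 * \<delta>)))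
       + K * (sqrt 2 / 3 * T * M / (sqrt m * m\<^sup>2)) * (b powr (2 - 2 * \<delta>) / (2 - 2 * \<delta>)))"
proof -
  define I where "I = integral {0..b} (\<lambda>x. V x * exp (- \<i> * of_real (f x)))"
  define S where "S = of_real (sqrt (2 * pi) / 2) * exp (- (\<i> * of_real (pi / 4))) * (V 0 / of_real (sqrt (f2 0)))"
  define W where "W = sqrt 2 * sqrt M / m"
  define W' where "W' = sqrt 2 / 3 * T * M / (sqrt m * m\<^sup>2)"
  define A where "A = L_const \<delta> * (m / 2) powr (1/2 - \<delta>)"
  define F where "F x = V x * of_real (jacobian x) * fresnel_primitive (sqrt (f x))" for x
  \<comment> \<open>The remainder integrand. Its value at the origin, where \<open>jacobian'\<close> is \<open>0/0\<close>, is set to zero.\<close>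
  define H where "H x = (if x = 0 then 0 else (V' x * of_real (jacobian x) + V x * of_real (jacobian' x)) * fresnel_primitive (sqrt (f x)))" for x
  have contf: "continuous_on X f" for X
    by (intro continuous_at_imp_continuous_on ballI DERIV_isCont[OF f])
  have contV: "continuous_on X V" for X
    by (intro continuous_at_imp_continuous_on ballI has_vector_derivative_continuous[OF V])
  have L: "0 < L_const \<delta>" by (rule L_const_pos)
  have A: "0 < A" and W: "0 < W" and W': "0 \<le> W'" and K0: "0 \<le> K"
    using L m M_pos T_nonneg K[of 0] b by (auto simp: A_def W_def W'_def intro: order_trans[OF norm_ge_zero])
  have \<Phi>: "cmod (fresnel_primitive (sqrt (f x))) \<le> A * x powr (1 - 2 * \<delta>)" if "x \<in> {0<..b}" for x
  proof -
    have x: "0 < x" "x \<in> {0..b}" using that by auto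
    have "cmod (fresnel_primitive (sqrt (f x))) \<le> L_const \<delta> * sqrt (f x) powr (1 - 2 * \<delta>)"
      using f_pos[OF that] \<delta> by (intro norm_fresnel_primitive_le_L) auto
    also have "sqrt (f x) powr (1 - 2 * \<delta>) = f x powr (1/2 - \<delta>)"
      using f_pos[OF that] by (simp add: powr_half_sqrt[symmetric] powr_powr field_simps)
    also have "\<dots> \<le> (m / 2 * x\<^sup>2) powr (1/2 - \<delta>)"
      using f_bounds(1)[OF x(2)] \<delta> x m by (intro powr_mono2') auto
    also have "\<dots> = (m / 2) powr (1/2 - \<delta>) * x powr (1 - 2 * \<delta>)"
    proof -
      have "x\<^sup>2 = x powr 2" using x by simp
      then show ?thesis using x m by (simp only: powr_mult powr_powr) (simp add: algebra_simps)
    qed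
    finally show ?thesis using L by (simp add: A_def mult.assoc)
  qed
  have FTC: "((\<lambda>x. H x + V x * exp (- \<i> * of_real (f x))) has_integral (F b - F 0)) {0..b}"
  proof (rule fundamental_theorem_of_calculus_interior)
    have "continuous_on {0..b} (\<lambda>x. fresnel_primitive (sqrt (f x)))"
    proof (rule continuous_on_compose2[OF continuous_fresnel_primitive[of "sqrt (M / 2 * b\<^sup>2)"]])
      show "(\<lambda>x. sqrt (f x)) ` {0..b} \<subseteq> {0..sqrt (M / 2 * b\<^sup>2)}"
      proof safe
        fix x assume x: "x \<in> {0..b}"
        have "f x \<le> M / 2 * x\<^sup>2" by (rule f_bounds[OF x])
        also have "\<dots> \<le> M / 2 * b\<^sup>2" using x M_pos by (intro mult_left_mono power_mono) auto
        finally show "sqrt (f x) \<in> {0..sqrt (M / 2 * b\<^sup>2)}" using f_nonneg[OF x]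
          by (metis atLeastAtMost_iff real_sqrt_ge_zero real_sqrt_le_mono)
      qed
    qed (intro continuous_intros contf)
    then show "continuous_on {0..b} F"
      unfolding F_def by (intro continuous_intros contV continuous_jacobian)
    fix x assume "x \<in> {0<..<b}"
    then have x: "x \<in> {0<..b}" "x \<noteq> 0" by auto
    have fx: "0 < f x" "0 < f1 x" using f_pos[OF x(1)] f1_pos[OF x(1)] by auto
    have D: "((\<lambda>x. sqrt (f x)) has_real_derivative inverse (jacobian x)) (at x)"
      by (rule DERIV_cong[OF DERIV_chain2[OF DERIV_real_sqrt[OF fx(1)] f]])
        (use fx in \<open>simp add: jacobian_def x field_simps\<close>)
    have "(fresnel_primitive has_vector_derivative exp (- \<i> * of_real ((sqrt (f x))\<^sup>2))) (at (sqrt (f x)))"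
      using fx by (intro fresnel_primitive_deriv) auto
    then have \<Phi>_deriv: "((\<lambda>x. fresnel_primitive (sqrt (f x))) has_vector_derivative inverse (jacobian x) *\<^sub>R exp (- \<i> * of_real (f x))) (at x)"
      using vector_diff_chain_at[OF D[unfolded has_real_derivative_iff_has_vector_derivative]] fx
      by (simp add: o_def)
    have cancel: "complex_of_real (jacobian x) * (inverse (complex_of_real (jacobian x)) * z) = z" for z
      using jacobian_bounds(1)[OF x(1)] by simp
    from has_vector_derivative_mult[OF has_vector_derivative_mult[OF V has_vector_derivative_of_real[OF jacobian_deriv[OF x(1)]]] \<Phi>_deriv]
    show "(F has_vector_derivative H x + V x * exp (- \<i> * of_real (f x))) (at x)"
      unfolding F_def[abs_def] H_def using x cancel
      by (simp add: scaleR_conv_of_real algebra_simps)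
  qed (use b in simp)
  have I: "((\<lambda>x. V x * exp (- \<i> * of_real (f x))) has_integral I) {0..b}"
    unfolding I_def
    by (intro integrable_integral integrable_continuous_real continuous_intros contV contf)
  have F0: "F 0 = - S"
  proof -
    have "jacobian 0 = sqrt 2 / sqrt (f2 0)" by (simp add: jacobian_def real_sqrt_divide)
    then show ?thesis
      by (simp add: F_def S_def f_0 fresnel_primitive_0 real_sqrt_mult ac_simps)
  qed
  have Fb: "F b = 0" by (simp add: F_def Vb)
  have H: "(H has_integral (S - I)) {0..b}"
    using has_integral_diff[OF FTC I] by (simp add: F0 Fb)
  define P where "P = integral {0..b} (\<lambda>x. (cmod (V' x))\<^sup>2)"
  define Q where "Q = b powr (3 - 4 * \<delta>) / (3 - 4 * \<delta>)"
  define B where "B = b powr (2 - 2 * \<delta>) / (2 - 2 * \<delta>)"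
  have P: "((\<lambda>x. (cmod (V' x))\<^sup>2) has_integral P) {0..b}"
    unfolding P_def by (intro integrable_integral integrable_continuous_real continuous_intros V')
  have P0: "0 \<le> P" using P by (rule has_integral_nonneg) auto
  have Q: "((\<lambda>x. x powr (2 - 4 * \<delta>)) has_integral Q) {0..b}"
    using has_integral_powr_from_0[of "2 - 4 * \<delta>" b] \<delta> b by (simp add: Q_def algebra_simps)
  have B: "((\<lambda>x. x powr (1 - 2 * \<delta>)) has_integral B) {0..b}"
    using has_integral_powr_from_0[of "1 - 2 * \<delta>" b] \<delta> b by (simp add: B_def algebra_simps)
  have Q0: "0 < Q" using b \<delta> by (simp add: Q_def)
  have key: "cmod (S - I) \<le> A * (W * (t / 2 * P + 1 / (2 * t) * Q) + K * W' * B)" if t: "0 < t" for t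
  proof -
    let ?g = "\<lambda>x. A * (W * (t / 2 * (cmod (V' x))\<^sup>2 + 1 / (2 * t) * x powr (2 - 4 * \<delta>)) + K * W' * x powr (1 - 2 * \<delta>))"
    have g: "(?g has_integral A * (W * (t / 2 * P + 1 / (2 * t) * Q) + K * W' * B)) {0..b}"
      by (intro has_integral_mult_right has_integral_add P Q B)
    have "norm (integral {0..b} H) \<le> integral {0..b} ?g"
    proof (rule integral_norm_bound_integral)
      fix x assume x: "x \<in> {0..b}"
      show "norm (H x) \<le> ?g x"
      proof (cases "x = 0")
        case True
        then show ?thesis using A W K0 W' t by (simp add: H_def)
      next
        case False
        with x have x': "x \<in> {0<..b}" by auto
        define v p where "v = cmod (V' x)" and "p = x powr (1 - 2 * \<delta>)"
        have p2: "x powr (2 - 4 * \<delta>) = p\<^sup>2"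
          using x' by (simp add: p_def power2_eq_square flip: powr_add)
        \<comment> \<open>Young's inequality with parameter \<open>t\<close>, for \<open>le_sqrt_mult_of_Young\<close>\<close>
        have young: "v * p \<le> t / 2 * v\<^sup>2 + 1 / (2 * t) * p\<^sup>2"
        proof -
          have "0 \<le> (t * v - p)\<^sup>2 / (2 * t)" using t by simp
          also have "\<dots> = t / 2 * v\<^sup>2 + 1 / (2 * t) * p\<^sup>2 - v * p"
            using t by (simp add: field_simps power2_eq_square)
          finally show ?thesis by simp
        qed
        have "norm (H x) = cmod (V' x * of_real (jacobian x) + V x * of_real (jacobian' x)) * cmod (fresnel_primitive (sqrt (f x)))"
          using False by (simp add: H_def norm_mult)
        also have "\<dots> \<le> (v * W + K * W') * (A * p)"
        proof (intro mult_mono)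
          have "cmod (V' x * of_real (jacobian x)) \<le> v * W"
            using jacobian_bounds(1)[OF x'] mult_left_mono[OF jacobian_bounds(2)[OF x'] norm_ge_zero[of "V' x"]]
            unfolding norm_mult norm_of_real v_def W_def by simp
          moreover have "cmod (V x * of_real (jacobian' x)) \<le> K * W'"
            using jacobian'_bound[OF x'] K[OF x] K0 unfolding norm_mult norm_of_real W'_def
            by (intro mult_mono) auto
          ultimately show "cmod (V' x * of_real (jacobian x) + V x * of_real (jacobian' x)) \<le> v * W + K * W'"
            by (rule norm_triangle_mono)
          show "cmod (fresnel_primitive (sqrt (f x))) \<le> A * p"
            using \<Phi>[OF x'] by (simp add: p_def)
          show "0 \<le> v * W + K * W'" using W W' K0 by (simp add: v_def)
        qed simp
        also have "\<dots> = A * (W * (v * p) + K * W' * p)" by (simp add: algebra_simps)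
        also have "\<dots> \<le> A * (W * (t / 2 * v\<^sup>2 + 1 / (2 * t) * p\<^sup>2) + K * W' * p)"
          using young A W by (intro mult_left_mono add_right_mono) auto
        finally show ?thesis by (simp only: p2 v_def p_def)
      qed
    qed (use H g in blast)+
    then show ?thesis unfolding integral_unique[OF H] integral_unique[OF g] .
  qed
  have "(cmod (S - I) / A - K * W' * B) / W \<le> sqrt P * sqrt Q"
  proof (rule le_sqrt_mult_of_Young[OF _ P0 Q0])
    fix t :: real assume "0 < t"
    from key[OF this] have "cmod (S - I) / A \<le> W * (t / 2 * P + 1 / (2 * t) * Q) + K * W' * B"
      using A by (simp add: pos_divide_le_eq mult.commute)
    then show "(cmod (S - I) / A - K * W' * B) / W \<le> t / 2 * P + 1 / (2 * t) * Q"
      unfolding pos_divide_le_eq[OF W] by (simp add: mult.commute)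
  qed
  then have "cmod (S - I) / A \<le> W * (sqrt P * sqrt Q) + K * W' * B"
    unfolding pos_divide_le_eq[OF W] by (simp add: mult.commute)
  then have "cmod (S - I) \<le> A * (W * (sqrt P * sqrt Q) + K * W' * B)"
    unfolding pos_divide_le_eq[OF A] by (simp add: mult.commute)
  then show ?thesis
    by (subst norm_minus_commute) (simp only: A_def W_def W'_def P_def Q_def B_def I_def S_def)
qed

end

section \<open>Norms and constants\<close>

text \<open>
  For a continuous function the essential supremum over an open set dominates every value, because the
  set where it is exceeded is open and null. The bound \<open>B\<close> makes the essential supremum finite, so
  that the conversion to a real number is harmless.
\<close>

lemma norm_le_norm_Linf:
  fixes g :: "real \<Rightarrow> 'b::real_normed_vector"
  assumes g: "continuous_on UNIV g" and S: "open S" and B: "\<And>y. y \<in> S \<Longrightarrow> norm (g y) \<le> B" and x: "x \<in> S"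
  shows "norm (g x) \<le> norm_Linf (restrict_space lborel S) g"
proof -
  let ?M = "restrict_space lborel S" and ?g = "\<lambda>y. ereal (norm (g y))"
  define e where "e = esssup ?M ?g"
  have Ss: "S \<inter> space lborel \<in> sets lborel" using S by auto
  have cont: "continuous_on UNIV ?g"
    by (intro continuous_on_ereal continuous_on_norm g)
  have "?g \<in> borel_measurable borel" by (rule borel_measurable_continuous_onI[OF cont])
  then have meas: "?g \<in> borel_measurable ?M"
    by (intro measurable_restrict_space1) simp
  have "AE y in ?M. ?g y \<le> ereal B"
    using B by (auto simp: AE_restrict_space_iff[OF Ss])
  then have eB: "e \<le> ereal B" unfolding e_def by (rule esssup_I[OF meas])
  have "AE y in ?M. ?g y \<le> e" unfolding e_def by (rule esssup_AE)
  then have "AE y \<in> S in lebesgue. y \<in> {y. ?g y \<le> e}"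
    by (simp add: AE_restrict_space_iff[OF Ss] AE_completion)
  moreover have "closed {y. ?g y \<le> e}"
    using cont by (intro closed_Collect_le continuous_on_const)
  ultimately have "x \<in> {y. ?g y \<le> e}"
    using mem_closed_if_AE_lebesgue_open S x by blast
  then have xe: "?g x \<le> e" by simp
  show ?thesis
    unfolding norm_Linf_def e_def[symmetric] using xe eB by (cases e) auto
qed

lemma abs_le_norm_Linf_ivl:
  assumes g: "continuous_on UNIV g" and ab: "a < b" and x: "x \<in> {a..b}"
  shows "\<bar>g x\<bar> \<le> norm_Linf_ivl a b g"
proof -
  have "continuous_on {a..b} g" using g continuous_on_subset by blast
  then have "compact (g ` {a..b})" by (intro compact_continuous_image) auto
  then obtain B where B: "\<And>y. y \<in> {a..b} \<Longrightarrow> norm (g y) \<le> B"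
    by (meson bounded_iff compact_imp_bounded imageI)
  have cl: "closure {a<..<b} = {a..b}" using ab by simp
  show ?thesis
  proof (rule continuous_le_on_closure[where f = "\<lambda>x. \<bar>g x\<bar>" and S = "{a<..<b}"])
    show "continuous_on (closure {a<..<b}) (\<lambda>x. \<bar>g x\<bar>)"
      by (intro continuous_intros continuous_on_subset[OF g]) auto
    show "\<bar>g y\<bar> \<le> norm_Linf_ivl a b g" if "y \<in> {a<..<b}" for y
      using norm_le_norm_Linf[OF g, of "{a<..<b}" B y] B that by auto
  qed (use x cl in simp)
qed

lemma norm_le_norm_Linf_lborel:
  fixes U :: "real \<Rightarrow> 'b::real_normed_vector"
  assumes U: "continuous_on UNIV U" and supp: "\<And>y. y \<notin> {a..b} \<Longrightarrow> U y = 0"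
  shows "norm (U x) \<le> norm_Linf lborel U"
proof -
  have "continuous_on {a..b} U" using U continuous_on_subset by blast
  then have "compact (U ` {a..b})" by (intro compact_continuous_image) auto
  then obtain B where B: "\<And>y. y \<in> {a..b} \<Longrightarrow> norm (U y) \<le> B"
    by (meson bounded_iff compact_imp_bounded imageI)
  have "norm (U y) \<le> max B 0" for y
    using B[of y] supp[of y] by (cases "y \<in> {a..b}") auto
  from norm_le_norm_Linf[OF U open_UNIV this, of x]
  have "norm (U x) \<le> norm_Linf (restrict_space lborel UNIV) U" by simp
  moreover have "restrict_space lborel UNIV = (lborel :: real measure)"
    by (rule measure_eqI) (auto simp: sets_restrict_space emeasure_restrict_space)
  ultimately show ?thesis by simp
qed

text \<open>
  By compactness the minimum is attained, and the least element in its definition exists.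
\<close>

lemma min_neg_deriv2_le:
  assumes c: "continuous_on UNIV ((deriv ^^ 2) \<psi>)" and ab: "a \<le> b"
  shows "\<And>x. x \<in> {a..b} \<Longrightarrow> min_neg_deriv2 \<psi> a b \<le> - (deriv ^^ 2) \<psi> x"
    and "(\<And>x. (deriv ^^ 2) \<psi> x < 0) \<Longrightarrow> 0 < min_neg_deriv2 \<psi> a b"
proof -
  let ?h = "\<lambda>x. - (deriv ^^ 2) \<psi> x"
  have "continuous_on {a..b} ?h"
    by (intro continuous_intros continuous_on_subset[OF c]) auto
  then obtain x0 where x0: "x0 \<in> {a..b}" "\<And>y. y \<in> {a..b} \<Longrightarrow> ?h x0 \<le> ?h y"
    using continuous_attains_inf[of "{a..b}" ?h] ab by auto
  have eq: "min_neg_deriv2 \<psi> a b = ?h x0"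
    unfolding min_neg_deriv2_def using x0 by (intro Least_equality) auto
  show "min_neg_deriv2 \<psi> a b \<le> ?h x" if "x \<in> {a..b}" for x
    using x0(2)[OF that] eq by simp
  show "0 < min_neg_deriv2 \<psi> a b" if "\<And>x. (deriv ^^ 2) \<psi> x < 0"
    using that[of x0] eq by simp
qed

text \<open>
  The two coefficients of the one-sided estimate, with the large parameter \<open>\<omega>\<close> separated. Both scale
  exactly like \<open>\<omega> powr (- \<delta>)\<close>. In the application \<open>h = 2\<close>; a variable in its place lets all
  factors be treated as exponentials.
\<close>

lemma exponent_arithmetic:
  fixes m M \<omega> h \<delta> :: real
  assumes pos: "0 < m" "0 < M" "0 < \<omega>" "0 < h"
  shows "(\<omega> * m / h) powr (1/2 - \<delta>) * (sqrt h * sqrt (\<omega> * M) / (\<omega> * m))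
      = \<omega> powr - \<delta> * (h powr \<delta> * (M powr (1/2) * m powr (- 1/2 - \<delta>)))"
    and "(\<omega> * m / h) powr (1/2 - \<delta>) * (sqrt h * \<omega> * (\<omega> * M) / (sqrt (\<omega> * m) * (\<omega> * m)\<^sup>2))
      = \<omega> powr - \<delta> * (h powr \<delta> * (M * m powr (- 2 - \<delta>)))"
proof -
  obtain a b c d where e: "m = exp a" "M = exp b" "\<omega> = exp c" "h = exp d"
    using pos by (metis exp_ln)
  have sq: "sqrt (exp x) = exp (x / 2)" for x :: real
    by (simp add: powr_half_sqrt[symmetric] powr_def)
  have sqr: "(exp x)\<^sup>2 = exp (2 * x)" for x :: real
    by (simp add: exp_double)
  show "(\<omega> * m / h) powr (1/2 - \<delta>) * (sqrt h * sqrt (\<omega> * M) / (\<omega> * m))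
      = \<omega> powr - \<delta> * (h powr \<delta> * (M powr (1/2) * m powr (- 1/2 - \<delta>)))"
    unfolding e exp_add[symmetric] exp_diff[symmetric] sq powr_def
    by (simp add: exp_add[symmetric] exp_diff[symmetric] del: exp_diff exp_add) (simp add: field_simps)
  show "(\<omega> * m / h) powr (1/2 - \<delta>) * (sqrt h * \<omega> * (\<omega> * M) / (sqrt (\<omega> * m) * (\<omega> * m)\<^sup>2))
      = \<omega> powr - \<delta> * (h powr \<delta> * (M * m powr (- 2 - \<delta>)))"
    unfolding e exp_add[symmetric] exp_diff[symmetric] sq sqr powr_def
    by (simp add: exp_add[symmetric] exp_diff[symmetric] del: exp_diff exp_add) (simp add: field_simps)
qed

text \<open>
  Powers of \<open>m\<close> may be exchanged for powers of the larger number \<open>M\<close>. This is how the exponents of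
  the estimate become those of the constants.
\<close>

lemma powr_trade:
  fixes m M r s t :: real
  assumes "0 < m" "m \<le> M" "0 \<le> t"
  shows "M powr r * m powr s \<le> M powr (r + t) * m powr (s - t)"
proof -
  have "M powr r * m powr s = M powr r * m powr (s - t) * m powr t"
    using assms by (simp flip: powr_add)
  also have "\<dots> \<le> M powr r * m powr (s - t) * M powr t"
    using assms by (intro mult_left_mono powr_mono2) auto
  finally show ?thesis by (simp add: powr_add algebra_simps)
qed

text \<open>
  The one-sided estimate is at most half of the two-sided bound. For the part with \<open>P\<close> the only losses
  are \<open>m \<le> M\<close> and the enlargement of \<open>b\<close> to \<open>D\<close>. The part with \<open>K\<close> has a coefficient
  \<open>1/3\<close> where half of the first summand of \<open>C2\<close> alone offers \<open>1/2\<close>.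
\<close>

lemma constants_comparison:
  fixes m M T K p P b D \<omega> \<delta> :: real
  assumes m: "0 < m" "m \<le> M" and T: "0 \<le> T" and K: "0 \<le> K" and p: "0 \<le> p" "p \<le> P"
    and b: "0 < b" "b \<le> D" and \<omega>: "0 < \<omega>" and \<delta>: "1/2 < \<delta>" "\<delta> < 3/4"
  defines "C1 \<equiv> 2 powr (\<delta> + 1) * L_const \<delta> / sqrt (3 - 4 * \<delta>) * D powr ((3 - 4 * \<delta>) / 2) * M powr (3/2 - \<delta>) * m powr (-3/2)"
    and "C2 \<equiv> 2 powr (\<delta> - 1) * L_const \<delta> / (1 - \<delta>) * D powr (2 - 2 * \<delta>) *
     (M powr (5/2 - \<delta>) * T * m powr (-7/2) + 1/3 * M powr (7/2 - \<delta>) * T * m powr (-9/2))"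
  shows "L_const \<delta> * (\<omega> * m / 2) powr (1/2 - \<delta>) *
      (sqrt 2 * sqrt (\<omega> * M) / (\<omega> * m) * (p * sqrt (b powr (3 - 4 * \<delta>) / (3 - 4 * \<delta>)))
       + K * (sqrt 2 / 3 * (\<omega> * T) * (\<omega> * M) / (sqrt (\<omega> * m) * (\<omega> * m)\<^sup>2)) * (b powr (2 - 2 * \<delta>) / (2 - 2 * \<delta>)))
    \<le> (C1 * P + C2 * K) * \<omega> powr - \<delta> / 2"
proof -
  have M: "0 < M" and D: "0 < D" using m b by auto
  define L w where "L = L_const \<delta>" and "w = \<omega> powr - \<delta>"
  have L: "0 < L" and w: "0 < w" using \<omega> by (auto simp: L_def w_def L_const_pos)
  define A where "A = (\<omega> * m / 2) powr (1/2 - \<delta>)"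
  define G where "G = sqrt 2 * sqrt (\<omega> * M) / (\<omega> * m)"
  define G' where "G' = sqrt 2 * \<omega> * (\<omega> * M) / (sqrt (\<omega> * m) * (\<omega> * m)\<^sup>2)"
  define q where "q = sqrt (b powr (3 - 4 * \<delta>) / (3 - 4 * \<delta>))"
  define r where "r = b powr (2 - 2 * \<delta>) / (2 - 2 * \<delta>)"
  have AG: "A * G = w * (2 powr \<delta> * (M powr (1/2) * m powr (- 1/2 - \<delta>)))"
    and AG': "A * G' = w * (2 powr \<delta> * (M * m powr (- 2 - \<delta>)))"
    using exponent_arithmetic[OF m(1) M \<omega>, of 2 \<delta>] by (simp_all add: A_def G_def G'_def w_def)
  have q: "q \<le> D powr ((3 - 4 * \<delta>) / 2) / sqrt (3 - 4 * \<delta>)" "0 \<le> q"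
  proof -
    have "q = b powr ((3 - 4 * \<delta>) / 2) / sqrt (3 - 4 * \<delta>)"
      using b by (simp add: q_def real_sqrt_divide powr_half_sqrt[symmetric] powr_powr)
    also have "\<dots> \<le> D powr ((3 - 4 * \<delta>) / 2) / sqrt (3 - 4 * \<delta>)"
      using b \<delta> by (intro divide_right_mono powr_mono2) auto
    finally show "q \<le> D powr ((3 - 4 * \<delta>) / 2) / sqrt (3 - 4 * \<delta>)" .
  qed (use \<delta> in \<open>simp add: q_def\<close>)
  have r: "r \<le> D powr (2 - 2 * \<delta>) / (2 - 2 * \<delta>)" "0 \<le> r"
    using b \<delta> by (auto simp: r_def intro!: divide_right_mono powr_mono2)
  have E1: "M powr (1/2) * m powr (- 1/2 - \<delta>) \<le> M powr (3/2 - \<delta>) * m powr (-3/2)"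
    using powr_trade[OF m, of "1 - \<delta>" "1/2" "- 1/2 - \<delta>"] \<delta> by (simp add: algebra_simps)
  have E2: "M * m powr (- 2 - \<delta>) \<le> M powr (5/2 - \<delta>) * m powr (-7/2)"
    using powr_trade[OF m, of "3/2 - \<delta>" "1" "- 2 - \<delta>"] \<delta> M by (simp add: algebra_simps)
  define X1 where "X1 = M powr (1/2) * m powr (- 1/2 - \<delta>)"
  define Y1 where "Y1 = M powr (3/2 - \<delta>) * m powr (-3/2)"
  define X2 where "X2 = M * m powr (- 2 - \<delta>)"
  define Y2 where "Y2 = M powr (5/2 - \<delta>) * m powr (-7/2)"
  have XY: "X1 \<le> Y1" "X2 \<le> Y2" "0 \<le> X1" "0 \<le> X2"
    using E1 E2 M by (auto simp: X1_def Y1_def X2_def Y2_def)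
  have "L * (A * G) * (p * q) \<le> L * (w * (2 powr \<delta> * Y1)) * (P * (D powr ((3 - 4 * \<delta>) / 2) / sqrt (3 - 4 * \<delta>)))"
    unfolding AG X1_def[symmetric] using XY q p L w by (intro mult_mono) auto
  also have "\<dots> = C1 * P * w / 2"
    unfolding C1_def L_def[symmetric] Y1_def by (simp add: powr_add)
  finally have first: "L * (A * G) * (p * q) \<le> C1 * P * w / 2" .
  have "L * (K * (A * G') * (T / 3) * r) \<le> L * (K * (w * (2 powr \<delta> * Y2)) * (T / 3) * (D powr (2 - 2 * \<delta>) / (2 - 2 * \<delta>)))"
    unfolding AG' X2_def[symmetric] using XY r K L w T by (intro mult_mono) auto
  also have "\<dots> = (2 powr (\<delta> - 1) * L / (1 - \<delta>) * D powr (2 - 2 * \<delta>) * (2 / 3 * (Y2 * T))) * K * w / 2"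
  proof -
    have "2 powr \<delta> = 2 * (2::real) powr (\<delta> - 1)" by (simp add: powr_diff)
    moreover have "2 - 2 * \<delta> = 2 * (1 - \<delta>)" by simp
    ultimately show ?thesis using \<delta> by (simp only:) (simp add: divide_simps)
  qed
  also have "\<dots> \<le> C2 * K * w / 2"
  proof -
    have "0 \<le> Y2 * T" "0 \<le> M powr (7/2 - \<delta>) * T * m powr (-9/2)"
      using T by (auto simp: Y2_def)
    then have "2 / 3 * (Y2 * T) \<le> M powr (5/2 - \<delta>) * T * m powr (-7/2) + 1/3 * M powr (7/2 - \<delta>) * T * m powr (-9/2)"
      by (simp add: Y2_def mult_ac)
    then show ?thesis
      unfolding C2_def L_def[symmetric] using K w L \<delta>
      by (intro divide_right_mono mult_right_mono mult_left_mono) auto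
  qed
  finally have second: "L * (K * (A * G') * (T / 3) * r) \<le> C2 * K * w / 2" .
  have "L * A * (G * (p * q) + K * (sqrt 2 / 3 * (\<omega> * T) * (\<omega> * M) / (sqrt (\<omega> * m) * (\<omega> * m)\<^sup>2)) * r)
      = L * (A * G) * (p * q) + L * (K * (A * G') * (T / 3) * r)"
    by (simp add: G'_def algebra_simps)
  also have "\<dots> \<le> (C1 * P + C2 * K) * w / 2"
    using first second by (simp add: algebra_simps)
  finally show ?thesis
    by (simp only: L_def A_def G_def q_def r_def w_def)
qed

section \<open>Both sides together\<close>

lemma C_k_real_3D:
  assumes "C_k_real 3 \<psi>"
  shows "\<And>x. (\<psi> has_real_derivative deriv \<psi> x) (at x)"
    and "\<And>x. (deriv \<psi> has_real_derivative (deriv ^^ 2) \<psi> x) (at x)"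
    and "\<And>x. ((deriv ^^ 2) \<psi> has_real_derivative (deriv ^^ 3) \<psi> x) (at x)"
    and "continuous_on UNIV ((deriv ^^ 3) \<psi>)"
proof -
  have D: "((deriv ^^ j) \<psi> has_real_derivative (deriv ^^ Suc j) \<psi> x) (at x)" if "j < 3" for j x
    using assms that by (simp add: C_k_real_def DERIV_deriv_iff_real_differentiable)
  show "(\<psi> has_real_derivative deriv \<psi> x) (at x)" for x using D[of 0 x] by simp
  show "(deriv \<psi> has_real_derivative (deriv ^^ 2) \<psi> x) (at x)" for x
    using D[of 1 x] by (simp add: numeral_2_eq_2)
  show "((deriv ^^ 2) \<psi> has_real_derivative (deriv ^^ 3) \<psi> x) (at x)" for x
    using D[of 2 x] by (simp only: numeral_3_eq_3 numeral_2_eq_2)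
  show "continuous_on UNIV ((deriv ^^ 3) \<psi>)" using assms by (simp add: C_k_real_def)
qed

lemma integral_square_le_norm_L2:
  fixes g :: "real \<Rightarrow> complex"
  assumes g: "continuous_on UNIV g" and supp: "\<And>y. y \<notin> {a..c} \<Longrightarrow> g y = 0" and \<sigma>: "\<bar>\<sigma>\<bar> = 1"
  shows "sqrt (integral {0..b} (\<lambda>x. (cmod (g (p + \<sigma> * x)))\<^sup>2)) \<le> norm_L2 lborel g"
proof -
  let ?h = "\<lambda>x. (cmod (g x))\<^sup>2" and ?k = "\<lambda>x. (cmod (g (p + \<sigma> * x)))\<^sup>2"
  have "integrable lborel (\<lambda>x. indicator {a..c} x *\<^sub>R ?h x)"
    by (intro borel_integrable_compact continuous_intros continuous_on_subset[OF g]) auto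
  moreover have "(\<lambda>x. indicator {a..c} x *\<^sub>R ?h x) = ?h"
    using supp by (auto simp: fun_eq_iff indicator_def)
  ultimately have int: "integrable lborel ?h" by simp
  have int': "integrable lborel ?k"
    using lborel_integrable_real_affine[OF int, of \<sigma> p] \<sigma> by auto
  have cont: "continuous_on {0..b} ?k"
    by (intro continuous_intros continuous_on_compose2[OF g]) auto
  have si: "set_integrable lborel {0..b} ?k"
    by (rule borel_integrable_atLeastAtMost'[OF cont])
  have "integral {0..b} ?k = (LINT x:{0..b}|lborel. ?k x)"
    using set_borel_integral_eq_integral(2)[OF si] by simp
  also have "\<dots> \<le> (LINT x|lborel. ?k x)"
    unfolding set_lebesgue_integral_def using si int'
    by (intro integral_mono) (auto simp: set_integrable_def indicator_def)
  also have "\<dots> = (LINT x|lborel. ?h x)"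
    using lborel_integral_real_affine[of \<sigma> ?h p] \<sigma> by auto
  finally show ?thesis by (simp add: norm_L2_def)
qed

text \<open>
  Both sides of the stationary point at once: \<open>\<sigma> = 1\<close> is the right one, \<open>\<sigma> = -1\<close> the left one.
  The phase \<open>x \<mapsto> \<omega> * (\<psi> p0 - \<psi> (p0 + \<sigma> * x))\<close> meets the assumptions of
  \<open>half_line_phase\<close>, and the unimodular factor \<open>exp (\<i> * \<omega> * \<psi> p0)\<close> does not change norms. Each side
  contributes half of the leading term.
\<close>

lemma one_sided_stationary_phase:
  fixes \<psi> :: "real \<Rightarrow> real" and U :: "real \<Rightarrow> complex"
  assumes C3: "C_k_real 3 \<psi>" and concave: "\<And>p. (deriv ^^ 2) \<psi> p < 0" and stat: "deriv \<psi> p0 = 0"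
    and U: "\<And>x. (U has_vector_derivative U' x) (at x)" and U': "continuous_on UNIV U'"
    and supp: "\<And>x. x \<notin> {a..c} \<Longrightarrow> U x = 0" "\<And>x. x \<notin> {a..c} \<Longrightarrow> U' x = 0"
    and \<delta>: "1/2 < \<delta>" "\<delta> < 3/4" and \<omega>: "0 < \<omega>" and ac: "a < c"
    and \<sigma>: "\<sigma> = 1 \<or> \<sigma> = -1" and b_bounds: "0 < b" "b \<le> c - a"
    and range: "\<And>x. x \<in> {0..b} \<Longrightarrow> p0 + \<sigma> * x \<in> {a..c}" and Ub: "U (p0 + \<sigma> * b) = 0"
  shows "cmod (integral {0..b} (\<lambda>x. U (p0 + \<sigma> * x) * exp (\<i> * of_real (\<omega> * \<psi> (p0 + \<sigma> * x))))
      - of_real (sqrt (2 * pi)) * exp (- (\<i> * of_real (pi / 4))) * exp (\<i> * of_real (\<omega> * \<psi> p0))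
        * (U p0 / of_real (sqrt (- (deriv ^^ 2) \<psi> p0))) * of_real (\<omega> powr (-1/2)) / 2)
    \<le> (C1_const \<psi> \<delta> a c * norm_L2 lborel U' + C2_const \<psi> \<delta> a c * norm_Linf lborel U) * \<omega> powr - \<delta> / 2"
    (is "cmod (?I - ?S) \<le> ?R")
proof -
  note D = C_k_real_3D[OF C3]
  define m where "m = min_neg_deriv2 \<psi> a c"
  define M where "M = norm_Linf_ivl a c ((deriv ^^ 2) \<psi>)"
  define T where "T = norm_Linf_ivl a c ((deriv ^^ 3) \<psi>)"
  have cont2: "continuous_on UNIV ((deriv ^^ 2) \<psi>)"
    by (intro continuous_at_imp_continuous_on ballI DERIV_isCont[OF D(3)])
  have contU: "continuous_on UNIV U"
    by (intro continuous_at_imp_continuous_on ballI has_vector_derivative_continuous[OF U])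
  have cont\<psi>: "continuous_on X \<psi>" for X
    by (intro continuous_at_imp_continuous_on ballI DERIV_isCont[OF D(1)])
  have m_pos: "0 < m" and m_le: "\<And>x. x \<in> {a..c} \<Longrightarrow> m \<le> - (deriv ^^ 2) \<psi> x"
    unfolding m_def using min_neg_deriv2_le[OF cont2] ac concave by auto
  have M_ge: "\<And>x. x \<in> {a..c} \<Longrightarrow> - (deriv ^^ 2) \<psi> x \<le> M"
    using abs_le_norm_Linf_ivl[OF cont2 ac] unfolding M_def by fastforce
  have T_ge: "\<And>x. x \<in> {a..c} \<Longrightarrow> \<bar>(deriv ^^ 3) \<psi> x\<bar> \<le> T"
    unfolding T_def by (rule abs_le_norm_Linf_ivl[OF D(4) ac])
  have mM: "m \<le> M" and T: "0 \<le> T"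
    using m_le[of a] M_ge[of a] T_ge[of a] ac by auto
  have \<sigma>2: "\<sigma> * \<sigma> = 1" "\<bar>\<sigma>\<bar> = 1" using \<sigma> by auto
  have K: "cmod (U x) \<le> norm_Linf lborel U" for x
    by (rule norm_le_norm_Linf_lborel[OF contU supp(1)])
  let ?f = "\<lambda>x. \<omega> * (\<psi> p0 - \<psi> (p0 + \<sigma> * x))"
  have aff: "((\<lambda>x. p0 + \<sigma> * x) has_real_derivative \<sigma>) (at x)" for x
    by (auto intro!: derivative_eq_intros)
  interpret half_line_phase b "\<omega> * m" "\<omega> * M" "\<omega> * T" ?f
    "\<lambda>x. - (\<omega> * \<sigma>) * deriv \<psi> (p0 + \<sigma> * x)" "\<lambda>x. - \<omega> * (deriv ^^ 2) \<psi> (p0 + \<sigma> * x)"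
    "\<lambda>x. - (\<omega> * \<sigma>) * (deriv ^^ 3) \<psi> (p0 + \<sigma> * x)"
  proof
    show "(?f has_real_derivative - (\<omega> * \<sigma>) * deriv \<psi> (p0 + \<sigma> * x)) (at x)" for x
      by (rule DERIV_cong[OF DERIV_cmult[OF DERIV_diff[OF DERIV_const DERIV_chain2[OF D(1) aff]]]]) simp
    show "((\<lambda>x. - (\<omega> * \<sigma>) * deriv \<psi> (p0 + \<sigma> * x)) has_real_derivative - \<omega> * (deriv ^^ 2) \<psi> (p0 + \<sigma> * x)) (at x)" for x
      using \<sigma>2(1) by (intro DERIV_cong[OF DERIV_cmult[OF DERIV_chain2[OF D(2) aff]]]) (simp add: ac_simps)
    show "((\<lambda>x. - \<omega> * (deriv ^^ 2) \<psi> (p0 + \<sigma> * x)) has_real_derivative - (\<omega> * \<sigma>) * (deriv ^^ 3) \<psi> (p0 + \<sigma> * x)) (at x)" for x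
      by (rule DERIV_cong[OF DERIV_cmult[OF DERIV_chain2[OF D(3) aff]]]) simp
    show "\<omega> * m \<le> - \<omega> * (deriv ^^ 2) \<psi> (p0 + \<sigma> * x) \<and> - \<omega> * (deriv ^^ 2) \<psi> (p0 + \<sigma> * x) \<le> \<omega> * M"
      if "x \<in> {0..b}" for x
      using mult_left_mono[OF m_le[OF range[OF that]], of \<omega>] mult_left_mono[OF M_ge[OF range[OF that]], of \<omega>] \<omega> by simp
    show "\<bar>- (\<omega> * \<sigma>) * (deriv ^^ 3) \<psi> (p0 + \<sigma> * x)\<bar> \<le> \<omega> * T" if "x \<in> {0..b}" for x
      using mult_left_mono[OF T_ge[OF range[OF that]], of \<omega>] \<omega> \<sigma>2(2) by (simp add: abs_mult)
  qed (use b_bounds m_pos \<omega> stat in auto)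
  have V: "((\<lambda>x. U (p0 + \<sigma> * x)) has_vector_derivative \<sigma> *\<^sub>R U' (p0 + \<sigma> * x)) (at x)" for x
    using vector_diff_chain_at[OF aff[unfolded has_real_derivative_iff_has_vector_derivative] U]
    by (simp add: o_def)
  have "continuous_on {0..b} (\<lambda>x. \<sigma> *\<^sub>R U' (p0 + \<sigma> * x))"
    by (intro continuous_intros continuous_on_compose2[OF U']) auto
  note est = half_line_estimate[OF V this Ub K \<delta>]
  let ?J = "integral {0..b} (\<lambda>x. U (p0 + \<sigma> * x) * exp (- \<i> * of_real (?f x)))"
  let ?S' = "of_real (sqrt (2 * pi) / 2) * exp (- (\<i> * of_real (pi / 4))) *
      (U (p0 + \<sigma> * 0) / of_real (sqrt (- \<omega> * (deriv ^^ 2) \<psi> (p0 + \<sigma> * 0))))"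
  let ?e = "exp (\<i> * of_real (\<omega> * \<psi> p0))"
  have J: "?I = ?e * ?J"
  proof -
    have "?e * ?J = integral {0..b} (\<lambda>x. ?e * (U (p0 + \<sigma> * x) * exp (- \<i> * of_real (?f x))))"
      by simp
    also have "\<dots> = ?I"
    proof (rule integral_cong)
      fix x
      have "?e * exp (- \<i> * of_real (?f x)) = exp (\<i> * of_real (\<omega> * \<psi> (p0 + \<sigma> * x)))"
        unfolding exp_add[symmetric] by (simp add: algebra_simps)
      then show "?e * (U (p0 + \<sigma> * x) * exp (- \<i> * of_real (?f x))) = U (p0 + \<sigma> * x) * exp (\<i> * of_real (\<omega> * \<psi> (p0 + \<sigma> * x)))"
        by (metis mult.left_commute)
    qed
    finally show ?thesis ..
  qed
  have S: "?S = ?e * ?S'"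
  proof -
    have "sqrt (- \<omega> * (deriv ^^ 2) \<psi> (p0 + \<sigma> * 0)) = sqrt \<omega> * sqrt (- (deriv ^^ 2) \<psi> p0)"
      by (simp flip: real_sqrt_mult)
    moreover have "\<omega> powr (-1/2) = 1 / sqrt \<omega>"
      using \<omega> by (simp add: powr_minus_divide powr_half_sqrt)
    ultimately show ?thesis by (simp only:) (simp add: ac_simps)
  qed
  have "cmod (?I - ?S) = cmod (?J - ?S')"
    unfolding J S right_diff_distrib[symmetric] norm_mult by simp
  also have "\<dots> \<le> L_const \<delta> * (\<omega> * m / 2) powr (1/2 - \<delta>) *
      (sqrt 2 * sqrt (\<omega> * M) / (\<omega> * m) * (sqrt (integral {0..b} (\<lambda>x. (cmod (\<sigma> *\<^sub>R U' (p0 + \<sigma> * x)))\<^sup>2)) * sqrt (b powr (3 - 4 * \<delta>) / (3 - 4 * \<delta>)))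
       + norm_Linf lborel U * (sqrt 2 / 3 * (\<omega> * T) * (\<omega> * M) / (sqrt (\<omega> * m) * (\<omega> * m)\<^sup>2)) * (b powr (2 - 2 * \<delta>) / (2 - 2 * \<delta>)))"
    by (rule est)
  also have "\<dots> \<le> ?R"
    unfolding C1_const_def C2_const_def M_def[symmetric] T_def[symmetric] m_def[symmetric]
  proof (rule constants_comparison)
    show "sqrt (integral {0..b} (\<lambda>x. (cmod (\<sigma> *\<^sub>R U' (p0 + \<sigma> * x)))\<^sup>2)) \<le> norm_L2 lborel U'"
      using integral_square_le_norm_L2[OF U' supp(2) \<sigma>2(2)] by (simp add: \<sigma>2)
    show "0 \<le> sqrt (integral {0..b} (\<lambda>x. (cmod (\<sigma> *\<^sub>R U' (p0 + \<sigma> * x)))\<^sup>2))"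
      by (intro real_sqrt_ge_zero integral_nonneg integrable_continuous_real continuous_intros continuous_on_compose2[OF U']) auto
    show "0 \<le> norm_Linf lborel U" using K order_trans[OF norm_ge_zero] by blast
  qed (use m_pos mM T b_bounds \<omega> \<delta> in auto)
  finally show ?thesis .
qed

theorem theorem2p3:
  fixes p1 p2 pt1 pt2 p0 \<delta> \<omega> :: real
    and \<psi> :: "real \<Rightarrow> real"
    and U :: "real \<Rightarrow> complex"
  assumes "p1 \<le> p2" and "pt1 < pt2"
    and "{p1..p2} \<subseteq> {pt1<..<pt2}"
    and "C_k_real 3 \<psi>"
    and "strictly_concave_on UNIV \<psi>"
    and "\<forall>p. (deriv ^^ 2) \<psi> p < 0"
    and "p0 \<in> {pt1<..<pt2}"
    and "stationary_point \<psi> p0"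
    and "\<forall>p. stationary_point \<psi> p \<longrightarrow> p = p0"
    and "U C1_differentiable_on UNIV"
    and "closure (support_on UNIV U) \<subseteq> {p1..p2}"
    and "\<delta> \<in> {1/2<..<3/4}"
    and "\<omega> > 0"
  shows "cmod ((LINT p|lborel. U p * exp (\<i> * of_real (\<omega> * \<psi> p)))
            - of_real (sqrt (2 * pi)) * exp (- (\<i> * of_real (pi / 4))) * exp (\<i> * of_real (\<omega> * \<psi> p0))
              * (U p0 / of_real (sqrt (- (deriv ^^ 2) \<psi> p0))) * of_real (\<omega> powr (-1/2)))
         \<le> (C1_const \<psi> \<delta> pt1 pt2 * norm_L2 lborel (\<lambda>p. vector_derivative U (at p))
            + C2_const \<psi> \<delta> pt1 pt2 * norm_Linf lborel U) * \<omega> powr (- \<delta>)"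
    (is "cmod (_ - ?S) \<le> ?R")
proof -
  define U' where "U' = (\<lambda>p. vector_derivative U (at p))"
  define F where "F = (\<lambda>p. U p * exp (\<i> * of_real (\<omega> * \<psi> p)))"
  have U: "(U has_vector_derivative U' x) (at x)" for x
    using assms(10) unfolding U'_def C1_differentiable_on_eq by (auto simp: vector_derivative_works)
  have U'_cont: "continuous_on UNIV U'"
    using assms(10) unfolding U'_def C1_differentiable_on_eq by auto
  have U_supp: "U x = 0" if "x \<notin> {p1..p2}" for x
    using assms(11) that closure_subset[of "support_on UNIV U"] by (auto simp: support_on_def)
  have U'_supp: "U' x = 0" if "x \<notin> {p1..p2}" for x
  proof -
    have "((\<lambda>x. 0) has_vector_derivative U' x) (at x)"
    proof (rule has_vector_derivative_transform_within_open[OF U])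
      show "open (- {p1..p2})" by (intro open_Compl closed_atLeastAtMost)
    qed (use that U_supp in auto)
    then show ?thesis
      using has_vector_derivative_const vector_derivative_unique_at by blast
  qed
  have out: "x \<notin> {p1..p2}" if "x \<notin> {pt1<..<pt2}" for x
    using assms(3) that by blast
  have supp: "U x = 0" "U' x = 0" if "x \<notin> {pt1..pt2}" for x
  proof -
    have "x \<notin> {p1..p2}" using that by (intro out) auto
    then show "U x = 0" "U' x = 0" by (fact U_supp U'_supp)+
  qed
  have ends: "U pt1 = 0" "U pt2 = 0"
    by (auto intro!: U_supp out simp del: atLeastAtMost_iff)
  have p0: "pt1 < p0" "p0 < pt2" using assms(7) by auto
  have stat: "deriv \<psi> p0 = 0" using assms(8) by (simp add: stationary_point_def)
  have \<delta>: "1/2 < \<delta>" "\<delta> < 3/4" using assms(12) by auto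
  have contF: "continuous_on X F" for X
  proof -
    have "continuous_on X \<psi>"
      by (intro continuous_at_imp_continuous_on ballI DERIV_isCont[OF C_k_real_3D(1)[OF assms(4)]])
    moreover have "continuous_on X U"
      by (intro continuous_at_imp_continuous_on ballI has_vector_derivative_continuous[OF U])
    ultimately show ?thesis unfolding F_def by (intro continuous_intros)
  qed
  have half: "cmod (integral {0..b} (\<lambda>x. F (p0 + \<sigma> * x)) - ?S / 2) \<le> ?R / 2"
    if "\<sigma> = 1 \<or> \<sigma> = -1" "0 < b" "b \<le> pt2 - pt1" "\<And>x. x \<in> {0..b} \<Longrightarrow> p0 + \<sigma> * x \<in> {pt1..pt2}"
      "U (p0 + \<sigma> * b) = 0" for \<sigma> b
    using one_sided_stationary_phase[OF assms(4) spec[OF assms(6)] stat U U'_cont supp \<delta> assms(13) assms(2) that]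
    unfolding F_def U'_def by simp
  have right: "cmod (integral {p0..pt2} F - ?S / 2) \<le> ?R / 2"
  proof -
    have "integral {p0..pt2} F = integral {0..pt2 - p0} (\<lambda>x. F (p0 + 1 * x))"
      using integral_shift_real_ivl[of p0 p0 pt2 F] by (simp add: add.commute)
    then show ?thesis using half[of 1 "pt2 - p0"] p0 ends by simp
  qed
  have left: "cmod (integral {pt1..p0} F - ?S / 2) \<le> ?R / 2"
  proof -
    have "integral {pt1..p0} F = integral {- p0..- pt1} (\<lambda>x. F (- x))" by simp
    also have "\<dots> = integral {0..p0 - pt1} (\<lambda>x. F (p0 + (-1) * x))"
      using integral_shift_real_ivl[of "- p0" "- p0" "- pt1" "\<lambda>x. F (- x)"] by simp
    finally show ?thesis using half[of "-1" "p0 - pt1"] p0 ends by simp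
  qed
  have "(LINT p|lborel. F p) = (LINT p:{pt1..pt2}|lborel. F p)"
    unfolding set_lebesgue_integral_def
    by (intro Bochner_Integration.integral_cong) (auto simp: indicator_def F_def supp)
  also have "\<dots> = integral {pt1..pt2} F"
    by (intro set_borel_integral_eq_integral borel_integrable_atLeastAtMost' contF)
  also have "\<dots> = integral {pt1..p0} F + integral {p0..pt2} F"
    using p0 by (intro Henstock_Kurzweil_Integration.integral_combine[symmetric] integrable_continuous_real contF) auto
  finally have split: "(LINT p|lborel. F p) - ?S = (integral {pt1..p0} F - ?S / 2) + (integral {p0..pt2} F - ?S / 2)"
    by simp
  have "cmod ((LINT p|lborel. F p) - ?S) \<le> ?R / 2 + ?R / 2"
    unfolding split by (rule norm_triangle_mono[OF left right])
  then show ?thesis unfolding F_def field_sum_of_halves .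
qed

end
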